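(* Let $q\in(0,1)$ and $\nu>-1$. Then the radius of starlikeness $r^*\left(h_{\nu}^{(3)}(\cdot;q)\right)$ of the function $$z\mapsto h_{\nu}^{(3)}(z;q)=c_{\nu}(q)z^{1-\frac{\nu}{2}}J_{\nu}^{(3)}(\sqrt{z};q)$$ is the smallest positive root of the equation $r\cdot \frac{d}{dr}J_{\nu}^{(3)}(r;q)-(\nu-2)J_{\nu}^{(3)}(r;q)=0$ and satisfies $$\frac{(1-q)(1-q^{\nu+1})}{2q}<r^*\left(h_{\nu}^{(3)}(\cdot;q)\right)<\frac{(q^2-1)(q^{\nu+1}-1)(q^{\nu+2}-1)}{q(q-q^{\nu+2}+2q^{\nu+3}-2)}$$ and $$\frac{(q-1)(q^{\nu+1}-1)}{2q}\sqrt{\frac{2(q^{\nu+2}-1)(q+1)}{q-q^{\nu+2}+2q^{\nu+3}-2}}<r^*\left(h_{\nu}^{(3)}(\cdot;q)\right)< \frac{(q^{\nu+1}-1)(q^{\nu+3}-1)(1-q)}{q(q+1)}\,q_4^*(\nu),$$ where $$q_4^*(\nu)=\frac{(q-q^{\nu+2}+2q^{\nu+3}-2)(q^3+2q^2+2q+1)} {q+q^2-q^3-4-5q^{\nu+2}+3q^{\nu+3}+10q^{\nu+4}+3q^{\nu+5}-5q^{\nu+6}-q^{2\nu+5}+q^{2\nu+6}+q^{2\nu+7}-4q^{2\nu+8}}.$$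
   Context: For $a\in\mathbb{C}$ and $q\in(0,1)$: $(a;q)_0=1$, $(a;q)_n=\prod_{k=1}^{n}(1-aq^{k-1})$, $(a;q)_\infty=\prod_{k\geq1}(1-aq^{k-1})$. The Hahn–Exton $q$-Bessel function is, for $\nu>-1$, $$J_{\nu}^{(3)}(z;q)=\frac{(q^{\nu+1};q)_{\infty}}{(q;q)_{\infty}}\sum_{n\geq0}\frac{(-1)^{n}z^{2n+\nu}}{(q;q)_{n}(q^{\nu+1};q)_{n}}q^{\frac{1}{2}n(n+1)},$$ and $c_{\nu}(q)=(q;q)_{\infty}/(q^{\nu+1};q)_{\infty}$; thus $h_\nu^{(3)}(z;q)=\sum_{n\ge0}\frac{(-1)^n q^{n(n+1)/2}}{(q;q)_n(q^{\nu+1};q)_n}z^{n+1}$ is entire with $h(0)=0$, $h'(0)=1$. For such $f$, the radius of starlikeness is $r^*(f)=\sup\{r>0:\ \mathrm{Re}\,(zf'(z)/f(z))>0 \text{ for all } |z|<r\}$.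
   Formalization: The radius of starlikeness is shown to be the square of the smallest positive root of the equation, not the root itself; because h is built from J at √z the literal claim fails (e.g. q=1/2, ν=0, where r*<3/8). *)

theory Defs
  imports "HOL-Analysis.Analysis"
begin

definition qpoch :: "real \<Rightarrow> real \<Rightarrow> nat \<Rightarrow> real" where
  "qpoch a q n = (\<Prod>k<n. 1 - a * q ^ k)"

definition qpoch_inf :: "real \<Rightarrow> real \<Rightarrow> real" where
  "qpoch_inf a q = (\<Prod>k. 1 - a * q ^ k)"

definition hahn_exton_J :: "real \<Rightarrow> real \<Rightarrow> real \<Rightarrow> real" where
  "hahn_exton_J q \<nu> r =
     qpoch_inf (q powr (\<nu> + 1)) q / qpoch_inf q q *
     (\<Sum>n. (-1) ^ n * r powr (2 * real n + \<nu>) * q powr (real n * (real n + 1) / 2)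
            / (qpoch q q n * qpoch (q powr (\<nu> + 1)) q n))"

text \<open>The normalized function h_nu^(3)(z;q) = c_nu(q) z^(1-nu/2) J_nu^(3)(sqrt z;q),
  given by its power series (entire, h(0)=0, h'(0)=1).\<close>
definition h3 :: "real \<Rightarrow> real \<Rightarrow> complex \<Rightarrow> complex" where
  "h3 q \<nu> z = (\<Sum>n. complex_of_real ((-1) ^ n * q powr (real n * (real n + 1) / 2)
                     / (qpoch q q n * qpoch (q powr (\<nu> + 1)) q n)) * z ^ (n + 1))"

text \<open>Radius of starlikeness. The point z = 0 is excluded since there z f'(z)/f(z)
  is a removable singularity (with value 1).\<close>
definition radius_starlike :: "(complex \<Rightarrow> complex) \<Rightarrow> real" where
  "radius_starlike f = Sup {r. 0 < r \<and>
      (\<forall>z. 0 < cmod z \<and> cmod z < r \<longrightarrow> 0 < Re (z * deriv f z / f z))}"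

end

theory Submission
  imports Defs "HOL-Computational_Algebra.Polynomial" "HOL-Real_Asymp.Real_Asymp"
begin

text \<open>
  Write \<open>a = q powr (\<nu> + 1)\<close> and \<open>h z = z * \<phi> z\<close>. Instead of a Hadamard factorization of \<open>\<phi>\<close> and \<open>h'\<close>, everything is a limit of
  facts about polynomials with positive zeros. The map \<open>p(z) \<mapsto> (p(z) - c p(q z)) / (1 - c)\<close>,
  \<open>0 \<le> c < 1\<close>, preserves the class of polynomials whose positive zeros \<open>x\<^sub>k\<close> satisfy
  \<open>x\<^sub>k\<^sub>+\<^sub>1 \<ge> x\<^sub>k / q\<close>, and moves zeros to the left. Applied with \<open>c = a, a q, a q\<^sup>2, \<dots>\<close>
  to \<open>\<Prod>\<^sub>k (1 - q\<^sup>k z)\<close> it produces polynomials \<open>P\<close> converging to \<open>\<phi>\<close>; by Rolle \<open>(z P)'\<close>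
  has positive zeros interlacing with those of \<open>P\<close>. The inequality
  \<open>Re (z h'/h) \<ge> r h'(r)/h(r)\<close>, \<open>r = |z|\<close>, then identifies the radius with the smallest zero
  \<open>\<gamma>\<close> of \<open>h'\<close>, and the four bounds are the Euler-Rayleigh inequalities
  \<open>1/\<sigma>\<^sub>1 < \<gamma> < \<sigma>\<^sub>1/\<sigma>\<^sub>2\<close> and \<open>\<sigma>\<^sub>2 powr (-1/2) < \<gamma> < \<sigma>\<^sub>2/\<sigma>\<^sub>3\<close> for the power sums
  \<open>\<sigma>\<^sub>j\<close> of the reciprocal zeros of \<open>h'\<close>.
\<close>

section \<open>Polynomials with positive zeros\<close>

text \<open>The parameters are reciprocal zeros, so the value at 0 is 1 and the number of factors
  can grow without rescaling. \<open>of_real\<close> lets one real sequence serve for real and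
  complex polynomials.\<close>

definition lin_prod :: "(nat \<Rightarrow> real) \<Rightarrow> nat \<Rightarrow> 'a::real_normed_field poly" where
  "lin_prod u N = (\<Prod>k<N. [:1, - of_real (u k):])"

lemma lin_prod_Suc: "lin_prod u (Suc N) = lin_prod u N * [:1, - of_real (u N):]"
  by (simp add: lin_prod_def)

lemma poly_lin_prod: "poly (lin_prod u N) z = (\<Prod>k<N. 1 - of_real (u k) * z)"
  by (simp add: lin_prod_def poly_prod mult.commute)

lemma degree_lin_prod_le: "degree (lin_prod u N) \<le> N"
proof (induction N)
  case 0
  then show ?case by (simp add: lin_prod_def)
next
  case (Suc N)
  have "degree (lin_prod u (Suc N) :: 'a poly) \<le> degree (lin_prod u N :: 'a poly) + degree [:1, - of_real (u N) :: 'a:]"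
    unfolding lin_prod_Suc by (rule degree_mult_le)
  also have "\<dots> \<le> N + 1" using Suc by (intro add_mono) auto
  finally show ?case by simp
qed

lemma coeff_lin_prod_eq_0: "N < n \<Longrightarrow> coeff (lin_prod u N) n = 0"
  by (rule coeff_eq_0) (rule le_less_trans[OF degree_lin_prod_le])

lemma coeff_lin_prod_Suc:
  "coeff (lin_prod u (Suc N)) n =
     coeff (lin_prod u N) n - of_real (u N) * (case n of 0 \<Rightarrow> 0 | Suc m \<Rightarrow> coeff (lin_prod u N) m)"
  unfolding lin_prod_Suc by (cases n) (simp_all add: coeff_pCons)

lemma coeff_lin_prod_of_real:
  "coeff (lin_prod u N :: 'a::real_normed_field poly) n = of_real (coeff (lin_prod u N) n)"
proof (induction N arbitrary: n)
  case 0
  then show ?case by (simp add: lin_prod_def coeff_1)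
next
  case (Suc N)
  then show ?case by (simp only: coeff_lin_prod_Suc) (simp add: Suc split: nat.split)
qed

text \<open>Casts a polynomial as a power series, the form in which Tannery's theorem compares
  approximants of different degrees.\<close>

lemma poly_lin_prod_sums:
  "(\<lambda>n. of_real (coeff (lin_prod u N) n) * z ^ n) sums poly (lin_prod u N) (z::'a::real_normed_field)"
proof -
  have "(\<lambda>n. of_real (coeff (lin_prod u N) n) * z ^ n) sums
          (\<Sum>n\<le>degree (lin_prod u N :: 'a poly). of_real (coeff (lin_prod u N) n) * z ^ n)"
    by (rule sums_finite) (auto simp flip: coeff_lin_prod_of_real simp: coeff_eq_0)
  then show ?thesis by (simp add: poly_altdef flip: coeff_lin_prod_of_real)
qed

lemma coeff_lin_prod_0: "coeff (lin_prod u N) 0 = 1"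
  by (induction N) (simp_all add: coeff_lin_prod_Suc, simp add: lin_prod_def)

section \<open>Newton's identities for the first three power sums of the reciprocal zeros\<close>

lemma newton_1: "(\<Sum>k<N. u k) = - coeff (lin_prod u N :: real poly) 1"
  by (induction N) (simp_all add: coeff_lin_prod_Suc coeff_lin_prod_0, simp add: lin_prod_def)

text \<open>Coefficient n is (-1)^n times the n-th elementary symmetric function of the
  \<open>u k\<close>, whence the signs; the induction appends one factor.\<close>

lemma newton_2:
  "(\<Sum>k<N. u k ^ 2) = coeff (lin_prod u N :: real poly) 1 ^ 2 - 2 * coeff (lin_prod u N) 2"
proof (induction N)
  case 0
  then show ?case by (simp add: lin_prod_def coeff_1)
next
  case (Suc N)
  then show ?case
    by (simp add: coeff_lin_prod_Suc coeff_lin_prod_0 numeral_2_eq_2)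
       (simp add: power2_eq_square algebra_simps)
qed

lemma newton_3:
  "(\<Sum>k<N. u k ^ 3) = 3 * coeff (lin_prod u N :: real poly) 1 * coeff (lin_prod u N) 2
      - coeff (lin_prod u N) 1 ^ 3 - 3 * coeff (lin_prod u N) 3"
proof (induction N)
  case 0
  then show ?case by (simp add: lin_prod_def coeff_1)
next
  case (Suc N)
  then show ?case
    by (simp add: coeff_lin_prod_Suc coeff_lin_prod_0 numeral_2_eq_2 numeral_3_eq_3)
       (simp add: power2_eq_square algebra_simps)
qed

text \<open>Both sides have degree at most N and agree at 0 and at N distinct zeros, hence at N + 1
  points.\<close>

lemma poly_eq_lin_prod:
  fixes p :: "real poly"
  assumes "degree p \<le> N" "poly p 0 = 1" "inj_on y {..<N}" "\<And>k. k < N \<Longrightarrow> poly p (y k) = 0"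
  shows "p = lin_prod (\<lambda>k. 1 / y k) N"
proof (rule poly_eqI_degree[where A = "insert 0 (y ` {..<N})"])
  have nz: "y k \<noteq> 0" if "k < N" for k
    using assms that by fastforce
  then have "card (insert 0 (y ` {..<N})) = Suc N"
    using assms(3) by (subst card_insert_disjoint) (auto simp: card_image)
  then show "degree p < card (insert 0 (y ` {..<N}))"
    "degree (lin_prod (\<lambda>k. 1 / y k) N :: real poly) < card (insert 0 (y ` {..<N}))"
    using assms(1) degree_lin_prod_le[of "\<lambda>k. 1 / y k" N] by (auto simp: less_Suc_eq_le)
  show "poly p x = poly (lin_prod (\<lambda>k. 1 / y k) N) x" if "x \<in> insert 0 (y ` {..<N})" for x
    using that assms(2,4) nz by (fastforce simp: poly_lin_prod)
qed

text \<open>The first j factors are nonpositive at \<open>x\<close>, the others nonnegative. Weak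
  inequalities allow \<open>x\<close> to be a zero itself.\<close>

lemma sign_lin_prod:
  fixes x :: real
  assumes "j \<le> N" "\<And>k. k < j \<Longrightarrow> 1 \<le> u k * x" "\<And>k. j \<le> k \<Longrightarrow> k < N \<Longrightarrow> u k * x \<le> 1"
  shows "0 \<le> (-1) ^ j * poly (lin_prod u N) x"
proof -
  have "{..<N} = {..<j} \<union> {j..<N}" using assms(1) by auto
  then have "(\<Prod>k<N. 1 - u k * x) = (\<Prod>k<j. 1 - u k * x) * (\<Prod>k\<in>{j..<N}. 1 - u k * x)"
    by (simp add: prod.union_disjoint ivl_disj_int)
  moreover have "(-1) ^ j * (\<Prod>k<j. 1 - u k * x) = (\<Prod>k<j. u k * x - 1)"
    by (induction j) (simp_all add: algebra_simps)
  moreover have "0 \<le> (\<Prod>k<j. u k * x - 1)" "0 \<le> (\<Prod>k\<in>{j..<N}. 1 - u k * x)"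
    using assms by (auto intro!: prod_nonneg)
  ultimately show ?thesis
    by (simp add: poly_lin_prod flip: mult.assoc)
qed

lemma poly_root_between:
  fixes p :: "real poly"
  assumes "x \<le> y" "0 \<le> (-1) ^ k * poly p x" "(-1) ^ k * poly p y \<le> 0"
  obtains z where "x \<le> z" "z \<le> y" "poly p z = 0"
proof -
  have "\<exists>z. x \<le> z \<and> z \<le> y \<and> - ((-1) ^ k * poly p z) = 0"
    by (rule IVT') (use assms in \<open>auto intro!: continuous_intros\<close>)
  then show ?thesis using that by auto
qed

section \<open>Two operators that keep all zeros positive: q-difference and derivative\<close>

lemma decseq_below:
  fixes u :: "nat \<Rightarrow> real"
  assumes "\<And>k. Suc k < N \<Longrightarrow> u (Suc k) \<le> u k" "i \<le> j" "j < N"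
  shows "u j \<le> u i"
  using assms(2,3) by (induction j rule: dec_induct) (use assms(1) in \<open>fastforce dest: order_trans\<close>)+

text \<open>In each interval from a zero of P(q x) (from 0 at first) to the next zero of P, the
  intermediate value theorem gives a zero of \<open>T\<close>; these N zeros exhaust the degree. The
  left ends carry the factor 1/q, which is why the separation is inherited.\<close>

lemma lin_prod_q_difference:
  fixes u :: "nat \<Rightarrow> real"
  assumes q: "0 < q" "q < 1" and c: "0 \<le> c" "c < 1"
    and pos: "\<And>k. k < N \<Longrightarrow> 0 < u k"
    and sep: "\<And>k. Suc k < N \<Longrightarrow> u (Suc k) \<le> q * u k"
  obtains w where "\<And>n. coeff (lin_prod w N) n = coeff (lin_prod u N) n * ((1 - c * q ^ n) / (1 - c))"
    "\<And>k. k < N \<Longrightarrow> u k \<le> w k" "\<And>k. Suc k < N \<Longrightarrow> w (Suc k) \<le> q * w k"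
proof -
  define P where "P = (lin_prod u N :: real poly)"
  define T where "T = smult (1 / (1 - c)) (P - smult c (pcompose P [:0, q:]))"
  have polyT: "poly T x = (poly P x - c * poly P (q * x)) / (1 - c)" for x
    by (simp add: T_def poly_pcompose mult.commute)
  have coeffT: "coeff T n = coeff P n * ((1 - c * q ^ n) / (1 - c))" for n
    by (simp add: T_def coeff_pcompose_linear) (simp add: diff_divide_distrib algebra_simps)
  have step: "u (Suc k) \<le> u k" if "Suc k < N" for k
    using sep[OF that] pos[of k] that q by (smt (verit) mult_le_cancel_right1 Suc_lessD)
  have mono: "u j \<le> u i" if "i \<le> j" "j < N" for i j
    using decseq_below[of N u i j] step that by blast
  have qmono: "u j \<le> q * u i" if "i < j" "j < N" for i j
    using mono[of "Suc i" j] sep[of i] that by fastforce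
  \<comment> \<open>\<open>l k\<close> is the zero of P(q x) belonging to \<open>u (k - 1)\<close>;
    for k = 0 the point 0, where \<open>T\<close> equals 1, takes its place.\<close>
  define l where "l k = (if k = 0 then 0 else 1 / (q * u (k - 1)))" for k
  have lx: "l k \<le> 1 / u k" if "k < N" for k
  proof (cases k)
    case 0
    then show ?thesis using pos[OF that] by (simp add: l_def)
  next
    case (Suc m)
    then show ?thesis using sep[of m] that pos[of k] pos[of m] q by (simp add: l_def frac_le)
  qed
  \<comment> \<open>For k > 0 the term P(q x) vanishes at \<open>l k\<close>, so \<open>T\<close>
    has the sign of P, and the zeros of P with index below k are those already passed.\<close>
  have signl: "0 \<le> (-1) ^ k * poly T (l k)" if "k < N" for k
  proof (cases k)
    case 0
    then show ?thesis using c by (simp add: l_def polyT P_def poly_lin_prod)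
  next
    case (Suc m)
    have m: "m < N" "0 < u m" using Suc that pos[of m] by auto
    have "poly P (q * l k) = 0"
      unfolding P_def poly_lin_prod using m q Suc by (intro prod_zero) (auto simp: l_def)
    moreover have "0 \<le> (-1) ^ k * poly P (l k)"
      unfolding P_def
    proof (rule sign_lin_prod)
      show "1 \<le> u i * l k" if "i < k" for i
        using mono[of i m] that m Suc q pos[of i]
        by (auto simp: l_def divide_simps) (smt (verit) mult_le_cancel_right1)
      show "u i * l k \<le> 1" if "k \<le> i" "i < N" for i
        using qmono[of m i] that m Suc q by (auto simp: l_def divide_simps)
    qed (use that in simp)
    ultimately show ?thesis using c by (simp add: polyT)
  qed
  \<comment> \<open>Here P itself vanishes and only - c P(q x) is left; by the separation, q / u k
    has still passed the zeros of index below k.\<close>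
  have signx: "(-1) ^ k * poly T (1 / u k) \<le> 0" if "k < N" for k
  proof -
    have uk: "0 < u k" using that pos by simp
    have "poly P (1 / u k) = 0"
      unfolding P_def poly_lin_prod using that uk by (intro prod_zero) auto
    moreover have "0 \<le> (-1) ^ k * poly P (q * (1 / u k))"
      unfolding P_def
    proof (rule sign_lin_prod)
      show "1 \<le> u i * (q * (1 / u k))" if "i < k" for i
        using qmono[of i k] that \<open>k < N\<close> uk by (auto simp: field_simps)
      show "u i * (q * (1 / u k)) \<le> 1" if "k \<le> i" "i < N" for i
        using mono[of k i] that uk q pos[of i] 
        by (auto simp: field_simps) (smt (verit) mult_le_cancel_right1)
    qed (use that in simp)
    ultimately show ?thesis using c
      by (simp add: polyT mult.left_commute[of _ c] mult_nonneg_nonneg)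
  qed
  have "\<exists>z. l k \<le> z \<and> z \<le> 1 / u k \<and> poly T z = 0" if "k < N" for k
    using poly_root_between[OF lx signl signx] that by metis
  then obtain y where y: "\<And>k. k < N \<Longrightarrow> l k \<le> y k \<and> y k \<le> 1 / u k \<and> poly T (y k) = 0"
    by metis
  have T0: "poly T 0 = 1" using c by (simp add: polyT P_def poly_lin_prod field_simps)
  have ypos: "0 < y k" if "k < N" for k
  proof -
    have "0 \<le> l k" using that pos[of "k - 1"] q by (cases k) (auto simp: l_def)
    moreover have "y k \<noteq> 0" using y[OF that] T0 by auto
    ultimately show ?thesis using y[OF that] by linarith
  qed
  \<comment> \<open>Distinctness comes from the gap between \<open>1 / u (k - 1)\<close> and
    \<open>l k\<close>, strict because q < 1.\<close>
  have yless: "y i < y k" if "i < k" "k < N" for i k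
  proof -
    have k: "k - 1 < N" "0 < u (k - 1)" "0 < u i" using that pos by auto
    have "y i \<le> 1 / u i" using y that by simp
    also have "\<dots> \<le> 1 / u (k - 1)" using mono[of i "k - 1"] that k by (simp add: frac_le)
    also have "\<dots> < 1 / (q * u (k - 1))"
      using q k by (simp add: divide_simps)
    also have "\<dots> \<le> y k" using y[of k] that by (simp add: l_def)
    finally show ?thesis .
  qed
  have "inj_on y {..<N}"
    by (rule linorder_inj_onI) (use yless in \<open>auto simp: less_imp_neq\<close>)
  moreover have "degree T \<le> N"
  proof (rule degree_le, safe)
    fix n assume "N < n"
    then have "coeff P n = 0" by (simp add: P_def coeff_lin_prod_eq_0)
    then show "coeff T n = 0" by (simp add: coeffT)
  qed
  ultimately have T: "T = lin_prod (\<lambda>k. 1 / y k) N"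
    using y T0 by (intro poly_eq_lin_prod) auto
  show thesis
  proof (rule that)
    show "coeff (lin_prod (\<lambda>k. 1 / y k) N) n = coeff (lin_prod u N) n * ((1 - c * q ^ n) / (1 - c))" for n
      using coeffT[of n] by (simp add: P_def flip: T)
    show uw: "u k \<le> 1 / y k" if "k < N" for k
      using y[OF that] ypos[OF that] pos[OF that] by (simp add: field_simps)
    show "1 / y (Suc k) \<le> q * (1 / y k)" if "Suc k < N" for k
    proof -
      have "1 / y (Suc k) \<le> q * u k"
        using y[OF that] ypos[OF that] pos[of k] that q by (simp add: l_def field_simps)
      also have "\<dots> \<le> q * (1 / y k)" using mult_left_mono[OF uw[of k], of q] that q by simp
      finally show ?thesis .
    qed
  qed
qed

text \<open>Rolle's theorem for z P(z): its zeros are 0 and the \<open>1 / u k\<close>, so N zeros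
  of the derivative lie between them and exhaust its degree.\<close>

lemma lin_prod_deriv:
  fixes u :: "nat \<Rightarrow> real"
  assumes pos: "\<And>k. k < N \<Longrightarrow> 0 < u k"
    and dec: "\<And>k. Suc k < N \<Longrightarrow> u (Suc k) < u k"
  obtains v where "\<And>n. coeff (lin_prod v N) n = real (Suc n) * coeff (lin_prod u N) n"
    "\<And>k. k < N \<Longrightarrow> u k \<le> v k" "\<And>k. Suc k < N \<Longrightarrow> v (Suc k) \<le> u k"
proof -
  define P where "P = (lin_prod u N :: real poly)"
  define Q where "Q = pderiv (pCons 0 P)"
  have coeffQ: "coeff Q n = real (Suc n) * coeff P n" for n
    by (simp add: Q_def coeff_pderiv)
  \<comment> \<open>For k = 0 the left end is the zero contributed by the factor z.\<close>
  define l where "l k = (if k = 0 then 0 else 1 / u (k - 1))" for k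
  have mono: "u j \<le> u i" if "i \<le> j" "j < N" for i j
    using decseq_below[of N u i j] less_imp_le[OF dec] that by blast
  have root: "poly P (1 / u k) = 0" if "k < N" for k
    unfolding P_def poly_lin_prod using that pos[OF that] by (intro prod_zero) auto
  have "\<exists>z. l k < z \<and> z < 1 / u k \<and> poly Q z = 0" if "k < N" for k
  proof -
    have less: "l k < 1 / u k"
      using pos[OF that] pos[of "k - 1"] dec[of "k - 1"] that
      by (auto simp: l_def field_simps)
    have "l k * poly P (l k) = 0" using root[of "k - 1"] that by (auto simp: l_def)
    with root[OF that] have "poly (pCons 0 P) (l k) = poly (pCons 0 P) (1 / u k)"
      by simp
    with poly_MVT[OF less, of "pCons 0 P"] less show ?thesis
      unfolding Q_def by (metis diff_gt_0_iff_gt diff_self less_irrefl mult_eq_0_iff)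
  qed
  then obtain y where y: "\<And>k. k < N \<Longrightarrow> l k < y k \<and> y k < 1 / u k \<and> poly Q (y k) = 0"
    by metis
  have ypos: "0 < y k" if "k < N" for k
    using y[OF that] pos[of "k - 1"] that by (cases k) (auto simp: l_def intro: less_trans[rotated])
  have yless: "y i < y k" if "i < k" "k < N" for i k
  proof -
    have k: "0 < u (k - 1)" "0 < u i" using that pos by auto
    have "y i < 1 / u i" using y that by simp
    also have "\<dots> \<le> 1 / u (k - 1)" using mono[of i "k - 1"] that k by (simp add: frac_le)
    also have "\<dots> < y k" using y[of k] that by (simp add: l_def)
    finally show ?thesis .
  qed
  have "inj_on y {..<N}"
    by (rule linorder_inj_onI) (use yless in \<open>auto simp: less_imp_neq\<close>)
  moreover have "degree Q \<le> N"
  proof (rule degree_le, safe)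
    fix n assume "N < n"
    then have "coeff P n = 0" by (simp add: P_def coeff_lin_prod_eq_0)
    then show "coeff Q n = 0" by (simp add: coeffQ)
  qed
  moreover have "poly Q 0 = 1"
    by (simp add: poly_0_coeff_0 coeffQ P_def coeff_lin_prod_0)
  ultimately have Q: "Q = lin_prod (\<lambda>k. 1 / y k) N"
    using y by (intro poly_eq_lin_prod) auto
  show thesis
  proof (rule that)
    show "coeff (lin_prod (\<lambda>k. 1 / y k) N) n = real (Suc n) * coeff (lin_prod u N) n" for n
      using coeffQ[of n] by (simp add: P_def flip: Q)
    show "u k \<le> 1 / y k" if "k < N" for k
      using y[OF that] ypos[OF that] pos[OF that] by (simp add: field_simps)
    show "1 / y (Suc k) \<le> u k" if "Suc k < N" for k
      using y[OF that] ypos[OF that] pos[of k] that by (simp add: l_def field_simps)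
  qed
qed

section \<open>Approximating polynomials\<close>

lemma triangular_Suc: "Suc m * (Suc m + 1) div 2 = m * (m + 1) div 2 + Suc m"
proof -
  have "Suc m * (Suc m + 1) = m * (m + 1) + 2 * Suc m" by simp
  then show ?thesis by (simp only: div_mult_self2[of 2])
qed

lemma qpoch_Suc: "qpoch a q (Suc n) = qpoch a q n * (1 - a * q ^ n)"
  by (simp add: qpoch_def)

lemma mult_power_less_1:
  fixes a q :: real
  assumes "0 < q" "q < 1" "a < 1"
  shows "a * q ^ k < 1"
proof (cases "0 \<le> a")
  case True
  have "a * q ^ k \<le> a * 1" using True assms by (intro mult_left_mono) (auto simp: power_le_one)
  then show ?thesis using assms by simp
next
  case False
  then have "a * q ^ k \<le> 0" using assms by (intro mult_nonpos_nonneg) auto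
  then show ?thesis by simp
qed

lemma qpoch_pos: "0 < q \<Longrightarrow> q < 1 \<Longrightarrow> a < 1 \<Longrightarrow> 0 < qpoch a q n"
  unfolding qpoch_def by (intro prod_pos) (simp add: mult_power_less_1)

text \<open>The algebra of the recursion in N, with X = q^(N+1), x = q^(N-m), y = q^(m+1). The
  relation X = x y is assumed only after multiplication by A: truncated subtraction breaks it for m
  > N, where A = 0.\<close>

lemma q_binomial_step:
  fixes A X :: real
  assumes X: "A * X = A * (x * y)" and nz: "y \<noteq> 1" "D \<noteq> 0"
  shows "- s * (E * y / (D * (1 - y))) * (A * (1 - x)) - X * (s * (E / D) * A)
    = - s * (E * y / (D * (1 - y))) * ((1 - X) * A)"
proof -
  have "X * (s * (E / D) * A) = s * (E / D) * (A * X)" "(1 - X) * A = A - A * X"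
    by (simp_all add: algebra_simps)
  note eqs = this[unfolded X]
  show ?thesis
    unfolding eqs using nz by (simp add: divide_simps) (simp add: algebra_simps)
qed

text \<open>The Gaussian binomial coefficient is split into its limit for large N and factors that
  tend to 1. For n > N the factor with j = N is 1 - q^0 = 0.\<close>

lemma coeff_lin_prod_powers:
  fixes q :: real
  assumes q: "0 < q" "q < 1"
  shows "coeff (lin_prod (\<lambda>k. q ^ Suc k) N) n =
    (-1) ^ n * (q ^ (n * (n + 1) div 2) / qpoch q q n) * (\<Prod>j<n. 1 - q ^ (N - j))"
proof (induction N arbitrary: n)
  case 0
  show ?case
    by (cases n) (simp_all add: lin_prod_def coeff_1 qpoch_def)
next
  case (Suc N)
  show ?case
  proof (cases n)
    case 0
    then show ?thesis by (simp add: coeff_lin_prod_0 qpoch_def)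
  next
    case (Suc m)
    define A where "A = (\<Prod>j<m. 1 - q ^ (N - j))"
    define E where "E = q ^ (m * (m + 1) div 2)"
    define D where "D = qpoch q q m"
    have D: "0 < D" using q by (simp add: D_def qpoch_pos)
    have y: "q ^ Suc m < 1" using mult_power_less_1[OF q q(2), of m] by simp
    have E': "q ^ (Suc m * (Suc m + 1) div 2) = E * q ^ Suc m"
      unfolding triangular_Suc E_def by (simp add: power_add)
    have D': "qpoch q q (Suc m) = D * (1 - q ^ Suc m)"
      by (simp add: D_def qpoch_Suc)
    have "(\<Prod>j<Suc m. 1 - q ^ (Suc N - j)) = (1 - q ^ Suc N) * A"
      unfolding A_def by (subst prod.lessThan_Suc_shift) simp
    moreover have "(\<Prod>j<Suc m. 1 - q ^ (N - j)) = A * (1 - q ^ (N - m))"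
      by (simp add: A_def)
    moreover have "A * q ^ Suc N = A * (q ^ (N - m) * q ^ Suc m)"
    proof (cases "m \<le> N")
      case True
      then show ?thesis by (simp flip: power_add add: Suc_diff_le)
    next
      case False
      then have "A = 0" unfolding A_def by (intro prod_zero) (auto intro!: bexI[of _ N])
      then show ?thesis by simp
    qed
    ultimately show ?thesis
      unfolding Suc coeff_lin_prod_Suc Suc.IH E' D' nat.case
      using q_binomial_step[of A "q ^ Suc N" "q ^ (N - m)" "q ^ Suc m" D "(-1) ^ m" E] y D
      by (simp only: A_def[symmetric] E_def[symmetric] D_def[symmetric] power_Suc[of "-1 :: real" m]
          mult_minus1 of_real_eq_id id_apply)
  qed
qed

text \<open>For 0 < q < 1 and a < 1 these are the absolute values of the Taylor coefficients of
  \<phi>.\<close>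

definition hx_weight :: "real \<Rightarrow> real \<Rightarrow> nat \<Rightarrow> real" where
  "hx_weight q a n = q ^ (n * (n + 1) div 2) / (qpoch q q n * qpoch a q n)"

text \<open>The ratio between the coefficients of the approximant with N zeros and those of \<phi>;
  it is 0 for n > N.\<close>

definition hx_damping :: "real \<Rightarrow> real \<Rightarrow> nat \<Rightarrow> nat \<Rightarrow> real" where
  "hx_damping q a N n = (\<Prod>j<n. (1 - q ^ (N - j)) * (1 - a * q ^ (N + j)))"

lemma hx_weight_pos: "0 < q \<Longrightarrow> q < 1 \<Longrightarrow> a < 1 \<Longrightarrow> 0 < hx_weight q a n"
  by (simp add: hx_weight_def qpoch_pos)

lemma hx_damping_bounds:
  assumes "0 < q" "q < 1" "0 < a" "a < 1"
  shows "0 \<le> hx_damping q a N n" "hx_damping q a N n \<le> 1"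
proof -
  have "0 \<le> 1 - q ^ k" "1 - q ^ k \<le> 1" "0 \<le> 1 - a * q ^ k" "1 - a * q ^ k \<le> 1" for k
    using mult_power_less_1[of q a k] power_le_one[of q k] assms by auto
  then show "0 \<le> hx_damping q a N n" "hx_damping q a N n \<le> 1"
    unfolding hx_damping_def by (auto intro!: prod_nonneg prod_le_1 mult_nonneg_nonneg mult_le_one)
qed

lemma hx_damping_tendsto:
  assumes "0 < q" "q < 1"
  shows "(\<lambda>N. hx_damping q a N n) \<longlonglongrightarrow> 1"
proof -
  have p: "(\<lambda>N. q ^ N) \<longlonglongrightarrow> 0" using assms by (intro LIMSEQ_power_zero) auto
  have m: "(\<lambda>N. q ^ (N - j)) \<longlonglongrightarrow> 0" for j
    by (rule filterlim_compose[OF p filterlim_minus_const_nat_at_top])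
  have "(\<lambda>N. (1 - q ^ (N - j)) * (1 - a * q ^ (N + j))) \<longlonglongrightarrow> (1 - 0) * (1 - a * 0)" for j
    by (rule tendsto_mult[OF tendsto_diff[OF tendsto_const m]
        tendsto_diff[OF tendsto_const tendsto_mult[OF tendsto_const LIMSEQ_ignore_initial_segment[OF p]]]])
  then have "(\<lambda>N. hx_damping q a N n) \<longlonglongrightarrow> (\<Prod>j<n. (1 - 0) * (1 - a * 0))"
    unfolding hx_damping_def by (intro tendsto_prod)
  then show ?thesis by simp
qed

text \<open>Round i uses c = a q^i and multiplies coefficient n by (1 - a q^(i+n)) / (1 - a q^i); M
  rounds telescope to n factors. Reciprocal zeros only grow, so \<open>q ^ Suc k\<close> stays a
  lower bound.\<close>

lemma hx_lin_prod_iterate: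
  assumes q: "0 < q" "q < 1" and a: "0 < a" "a < 1"
  shows "\<exists>u. (\<forall>n. coeff (lin_prod u N) n = coeff (lin_prod (\<lambda>k. q ^ Suc k) N) n
                 * (\<Prod>j<n. (1 - a * q ^ (M + j)) / (1 - a * q ^ j)))
           \<and> (\<forall>k<N. q ^ Suc k \<le> u k) \<and> (\<forall>k. Suc k < N \<longrightarrow> u (Suc k) \<le> q * u k)"
proof (induction M)
  case 0
  have "1 - a * q ^ j \<noteq> 0" for j using mult_power_less_1[of q a j] q a by auto
  then show ?case by (intro exI[of _ "\<lambda>k. q ^ Suc k"]) simp
next
  case (Suc M)
  then obtain u where u:
    "\<And>n. coeff (lin_prod u N) n = coeff (lin_prod (\<lambda>k. q ^ Suc k) N) n
                 * (\<Prod>j<n. (1 - a * q ^ (M + j)) / (1 - a * q ^ j))"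
    "\<And>k. k < N \<Longrightarrow> q ^ Suc k \<le> u k" "\<And>k. Suc k < N \<Longrightarrow> u (Suc k) \<le> q * u k"
    by blast
  have c: "0 \<le> a * q ^ M" "a * q ^ M < 1" using q a by (auto simp: mult_power_less_1)
  have pos: "0 < u k" if "k < N" for k
    using u(2)[OF that] q by (meson less_le_trans zero_less_power)
  obtain w where w:
    "\<And>n. coeff (lin_prod w N) n = coeff (lin_prod u N) n * ((1 - a * q ^ M * q ^ n) / (1 - a * q ^ M))"
    "\<And>k. k < N \<Longrightarrow> u k \<le> w k" "\<And>k. Suc k < N \<Longrightarrow> w (Suc k) \<le> q * w k"
    using lin_prod_q_difference[OF q c, of N u] pos u(3) by metis
  have "(\<Prod>j<n. (1 - a * q ^ (M + j)) / (1 - a * q ^ j)) * ((1 - a * q ^ M * q ^ n) / (1 - a * q ^ M))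
      = (\<Prod>j<n. (1 - a * q ^ (Suc M + j)) / (1 - a * q ^ j))" for n
  proof -
    \<comment> \<open>Both sides are the product of \<open>1 - a * q ^ (M + j)\<close> over j \<le>
      n, with the last or the first factor split off.\<close>
    have "(\<Prod>j<n. 1 - a * q ^ (M + j)) * (1 - a * q ^ (M + n)) = (1 - a * q ^ M) * (\<Prod>j<n. 1 - a * q ^ (Suc M + j))"
      using prod.lessThan_Suc[of "\<lambda>j. 1 - a * q ^ (M + j)" n]
        prod.lessThan_Suc_shift[of "\<lambda>j. 1 - a * q ^ (M + j)" n] by simp
    moreover have "A / C * (y / x) = B / C" if "A * y = x * B" "x \<noteq> 0" for A B C x y :: real
    proof -
      have "A / C * (y / x) = A * y / x / C" by simp
      then show ?thesis using that by simp
    qed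
    ultimately show ?thesis
      using c by (simp add: prod_dividef power_add mult.assoc)
  qed
  with w(1) u(1) have "coeff (lin_prod w N) n = coeff (lin_prod (\<lambda>k. q ^ Suc k) N) n
                 * (\<Prod>j<n. (1 - a * q ^ (Suc M + j)) / (1 - a * q ^ j))" for n
    by (simp only: mult.assoc)
  moreover have "q ^ Suc k \<le> w k" if "k < N" for k
    using u(2) w(2) that order_trans by blast
  ultimately show ?case using w(3) by blast
qed

text \<open>The polynomials \<open>lin_prod u N\<close> are rescaled little \<open>q\<close>-Laguerre polynomials.\<close>
lemma hx_approximants:
  assumes q: "0 < q" "q < 1" and a: "0 < a" "a < 1"
  obtains u v where
    "\<And>n. coeff (lin_prod u N) n = (-1) ^ n * hx_weight q a n * hx_damping q a N n"
    "\<And>n. coeff (lin_prod v N) n = real (Suc n) * ((-1) ^ n * hx_weight q a n) * hx_damping q a N n"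
    "\<And>k. k < N \<Longrightarrow> q ^ Suc k \<le> u k" "\<And>k. k < N \<Longrightarrow> u k \<le> v k"
    "\<And>k. Suc k < N \<Longrightarrow> u (Suc k) \<le> q * u k" "\<And>k. Suc k < N \<Longrightarrow> v (Suc k) \<le> u k"
proof -
  \<comment> \<open>As many rounds as zeros: one parameter then drives both groups of factors in
    \<open>hx_damping\<close> to 1.\<close>
  obtain u where u:
    "\<And>n. coeff (lin_prod u N) n = coeff (lin_prod (\<lambda>k. q ^ Suc k) N) n
                 * (\<Prod>j<n. (1 - a * q ^ (N + j)) / (1 - a * q ^ j))"
    "\<And>k. k < N \<Longrightarrow> q ^ Suc k \<le> u k" "\<And>k. Suc k < N \<Longrightarrow> u (Suc k) \<le> q * u k"
    using hx_lin_prod_iterate[OF q a, of N N] by blast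
  have pos: "0 < u k" if "k < N" for k
    using u(2)[OF that] q by (meson less_le_trans zero_less_power)
  have dec: "u (Suc k) < u k" if "Suc k < N" for k
  proof -
    have "q * u k < 1 * u k" using q pos[of k] that by (intro mult_strict_right_mono) auto
    then show ?thesis using u(3)[OF that] by simp
  qed
  have coeff: "coeff (lin_prod u N) n = (-1) ^ n * hx_weight q a n * hx_damping q a N n" for n
    unfolding u(1) coeff_lin_prod_powers[OF q]
    by (simp add: hx_weight_def hx_damping_def qpoch_def prod_dividef prod.distrib)
  obtain v where v:
    "\<And>n. coeff (lin_prod v N) n = real (Suc n) * coeff (lin_prod u N) n"
    "\<And>k. k < N \<Longrightarrow> u k \<le> v k" "\<And>k. Suc k < N \<Longrightarrow> v (Suc k) \<le> u k"
    using lin_prod_deriv[of N u] pos dec by metis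
  show thesis
    by (rule that[of u v]) (use coeff u v in \<open>auto simp: mult.assoc\<close>)
qed

section \<open>Convergence of the approximants to the entire series\<close>

lemma hx_weight_summable:
  fixes z :: "'a::{real_normed_field,banach}"
  assumes q: "0 < q" "q < 1" and a: "0 < a" "a < 1"
  shows "summable (\<lambda>n. of_real (real (Suc n) ^ j * hx_weight q a n) * z ^ n)"
proof (rule summable_norm_cancel)
  \<comment> \<open>The ratio of consecutive terms in norm; \<open>q ^ Suc n\<close> drives it to 0
    for every j and z.\<close>
  let ?r = "\<lambda>n. (real (n + 2) / real (n + 1)) ^ j * q ^ Suc n * norm z / ((1 - q ^ Suc n) * (1 - a * q ^ n))"
  have p: "(\<lambda>N. q ^ N) \<longlonglongrightarrow> 0" using q by (intro LIMSEQ_power_zero) auto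
  have "(\<lambda>n. real (n + 2) / real (n + 1)) \<longlonglongrightarrow> 1" by real_asymp
  from tendsto_power[OF this, of j] LIMSEQ_Suc[OF p] p
  have "?r \<longlonglongrightarrow> 1 ^ j * 0 * norm z / ((1 - 0) * (1 - a * 0))"
    by (intro tendsto_mult tendsto_divide tendsto_diff tendsto_const) auto
  then have "eventually (\<lambda>n. ?r n < 1 / 2) sequentially"
    by (intro order_tendstoD) auto
  then obtain n0 where n0: "\<And>n. n \<ge> n0 \<Longrightarrow> ?r n < 1 / 2"
    unfolding eventually_sequentially by blast
  show "summable (\<lambda>n. norm (of_real (real (Suc n) ^ j * hx_weight q a n) * z ^ n))"
  proof (rule summable_ratio_test)
    show "(1/2::real) < 1" by simp
    fix n assume "n \<ge> n0"
    note b = hx_weight_pos[OF q a(2), of n]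
    have pos: "0 < 1 - q ^ Suc n" "0 < 1 - a * q ^ n"
      using mult_power_less_1[OF q q(2), of n] mult_power_less_1[OF q a(2), of n] by auto
    have "hx_weight q a (Suc n) = hx_weight q a n * (q ^ Suc n / ((1 - q ^ Suc n) * (1 - a * q ^ n)))"
      unfolding hx_weight_def triangular_Suc qpoch_Suc by (simp add: power_add mult_ac)
    moreover have "(real (n + 2) / real (n + 1)) ^ j * real (Suc n) ^ j = real (Suc (Suc n)) ^ j"
      by (simp flip: power_mult_distrib)
    ultimately have "real (Suc (Suc n)) ^ j * hx_weight q a (Suc n) * norm z ^ Suc n
        = ?r n * (real (Suc n) ^ j * hx_weight q a n * norm z ^ n)"
      by (simp only: times_divide_eq_left times_divide_eq_right power_Suc[of "norm z"]) (simp add: mult_ac)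
    also have "\<dots> \<le> 1 / 2 * (real (Suc n) ^ j * hx_weight q a n * norm z ^ n)"
      using n0[OF \<open>n \<ge> n0\<close>] b by (intro mult_right_mono) auto
    finally show "norm (norm (of_real (real (Suc (Suc n)) ^ j * hx_weight q a (Suc n)) * z ^ Suc n))
        \<le> 1 / 2 * norm (norm (of_real (real (Suc n) ^ j * hx_weight q a n) * z ^ n))"
      using b hx_weight_pos[OF q a(2), of "Suc n"]
      by (simp add: norm_mult norm_power abs_mult del: of_real_mult power_Suc of_nat_Suc)
  qed
qed

text \<open>j = 0 gives \<phi> and j = 1 gives (z \<phi>)' = h', over the reals and the complex
  numbers alike.\<close>

definition hx_series :: "real \<Rightarrow> real \<Rightarrow> nat \<Rightarrow> 'a::{real_normed_field,banach} \<Rightarrow> 'a" where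
  "hx_series q a j z = (\<Sum>n. of_real (real (Suc n) ^ j * ((-1) ^ n * hx_weight q a n)) * z ^ n)"

text \<open>Tannery's theorem, dominated by the series at a bound R for the norms of the
  \<open>Z i\<close>. The arguments may move, which permits evaluation at the zeros of the
  approximants.\<close>

lemma hx_series_approx:
  fixes z :: "'a::{real_normed_field,banach}"
  assumes q: "0 < q" "q < 1" and a: "0 < a" "a < 1"
    and N: "filterlim N at_top sequentially" and Z: "Z \<longlonglongrightarrow> z"
    and coeff: "\<And>i n. coeff (lin_prod (w i) (N i)) n =
        real (Suc n) ^ j * ((-1) ^ n * hx_weight q a n) * hx_damping q a (N i) n"
  shows "(\<lambda>i. poly (lin_prod (w i) (N i)) (Z i)) \<longlonglongrightarrow> hx_series q a j z"
proof -
  obtain R where R: "\<And>i. norm (Z i) \<le> R"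
    using convergent_imp_Bseq[of Z] Z unfolding convergent_def Bseq_def by blast
  then have R0: "0 \<le> R" using norm_ge_zero order_trans by blast
  let ?t = "\<lambda>n i. of_real (real (Suc n) ^ j * ((-1) ^ n * hx_weight q a n) * hx_damping q a (N i) n) * Z i ^ n"
  have "(\<lambda>i. suminf (\<lambda>n. ?t n i)) \<longlonglongrightarrow>
      (\<Sum>n. of_real (real (Suc n) ^ j * ((-1) ^ n * hx_weight q a n) * 1) * z ^ n)"
  proof (rule conjunct2[OF conjunct2[OF tannerys_theorem]])
    show "(\<lambda>i. ?t n i) \<longlonglongrightarrow> of_real (real (Suc n) ^ j * ((-1) ^ n * hx_weight q a n) * 1) * z ^ n" for n
      by (intro tendsto_intros Z filterlim_compose[OF hx_damping_tendsto[OF q] N])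
    show "summable (\<lambda>n. real (Suc n) ^ j * hx_weight q a n * R ^ n)"
      using hx_weight_summable[OF q a, of j R] by simp
    have "norm (?t n i) \<le> real (Suc n) ^ j * hx_weight q a n * R ^ n" for n i
    proof -
      have "norm (?t n i) = (real (Suc n) ^ j * hx_weight q a n) * hx_damping q a (N i) n * norm (Z i) ^ n"
        using hx_weight_pos[OF q a(2), of n] hx_damping_bounds[OF q a, of "N i" n]
        by (simp only: norm_mult norm_power norm_of_real abs_mult power_abs) simp
      also have "\<dots> \<le> (real (Suc n) ^ j * hx_weight q a n) * 1 * R ^ n"
        using hx_weight_pos[OF q a(2), of n] hx_damping_bounds[OF q a, of "N i" n] R[of i] R0
        by (intro mult_mono power_mono mult_nonneg_nonneg) auto
      finally show ?thesis by simp
    qed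
    then show "\<forall>\<^sub>F (n, i) in at_top \<times>\<^sub>F sequentially. norm (?t n i) \<le> real (Suc n) ^ j * hx_weight q a n * R ^ n"
      by (simp add: always_eventually)
  qed simp
  moreover have "suminf (\<lambda>n. ?t n i) = poly (lin_prod (w i) (N i)) (Z i)" for i
    using poly_lin_prod_sums[of "w i" "N i" "Z i"] unfolding coeff by (rule sums_unique[symmetric])
  ultimately show ?thesis by (simp add: hx_series_def)
qed

section \<open>The smallest zero of the derivative\<close>

text \<open>Bernoulli's inequality (1 - t)^s \<le> 1 - s t with s = \<open>x k / t\<close> in [0,1].
  The bound depends on the sum alone, so it survives a limit in which N grows.\<close>

lemma prod_one_minus_ge_powr:
  fixes x :: "nat \<Rightarrow> real"
  assumes t: "0 < t" "t < 1" and x: "\<And>k. k < N \<Longrightarrow> 0 \<le> x k \<and> x k \<le> t"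
  shows "(1 - t) powr ((\<Sum>k<N. x k) / t) \<le> (\<Prod>k<N. 1 - x k)"
proof -
  have "(1 - t) powr (x k / t) \<le> 1 - x k" if "k < N" for k
  proof -
    have "x k / t * (1 - t) + (1 - x k / t) * 1 = 1 - x k"
      using t by (simp add: right_diff_distrib)
    then show ?thesis
      using Youngs_inequality_0[of "x k / t" "1 - x k / t" "1 - t" 1] x[OF that] t by simp
  qed
  then have "(\<Prod>k<N. (1 - t) powr (x k / t)) \<le> (\<Prod>k<N. 1 - x k)"
    by (intro prod_mono) auto
  moreover have "(\<Prod>k<N. (1 - t) powr (x k / t)) = (1 - t) powr ((\<Sum>k<N. x k) / t)"
    using t by (simp add: powr_sum sum_divide_distrib)
  ultimately show ?thesis by simp
qed

section \<open>Logarithmic derivatives of products of linear factors\<close>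

lemma poly_pderiv_lin_prod:
  fixes z :: "'a::real_normed_field"
  assumes "\<And>k. k < N \<Longrightarrow> 1 - of_real (u k) * z \<noteq> 0"
  shows "poly (pderiv (lin_prod u N)) z =
    - poly (lin_prod u N) z * (\<Sum>k<N. of_real (u k) / (1 - of_real (u k) * z))"
  using assms
proof (induction N)
  case 0
  then show ?case by (simp add: lin_prod_def)
next
  case (Suc N)
  have nz: "1 - of_real (u N) * z \<noteq> 0" using Suc.prems by simp
  have IH: "poly (pderiv (lin_prod u N)) z =
    - poly (lin_prod u N) z * (\<Sum>k<N. of_real (u k) / (1 - of_real (u k) * z))"
    using Suc by simp
  have step: "p * (- x) + D * (- p * S) = - (p * D) * (S + x / D)" if "D \<noteq> 0" for p x D S :: 'a
    using that by (simp add: distrib_left)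
  have "pderiv [:1, - of_real (u N) :: 'a:] = [:- of_real (u N):]"
    by (simp add: pderiv_pCons)
  then have "poly (pderiv (lin_prod u (Suc N))) z =
      poly (lin_prod u N) z * (- of_real (u N)) + (1 - of_real (u N) * z) * poly (pderiv (lin_prod u N)) z"
    unfolding lin_prod_Suc pderiv_mult by (simp add: algebra_simps)
  also have "\<dots> = - (poly (lin_prod u N) z * (1 - of_real (u N) * z)) *
      ((\<Sum>k<N. of_real (u k) / (1 - of_real (u k) * z)) + of_real (u N) / (1 - of_real (u N) * z))"
    unfolding IH by (rule step[OF nz])
  also have "poly (lin_prod u N) z * (1 - of_real (u N) * z) = poly (lin_prod u (Suc N)) z"
    by (simp add: poly_lin_prod)
  finally show ?case unfolding sum.lessThan_Suc .
qed

text \<open>The relation between the coefficients makes \<open>lin_prod v N\<close> the derivative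
  of z P for P = \<open>lin_prod u N\<close>, so the quotient is 1 + z P'/P.\<close>

lemma poly_lin_prod_ratio:
  fixes z :: "'a::real_normed_field"
  assumes coeff: "\<And>n. coeff (lin_prod v N) n = real (Suc n) * coeff (lin_prod u N) n"
    and nz: "\<And>k. k < N \<Longrightarrow> 1 - of_real (u k) * z \<noteq> 0"
  shows "poly (lin_prod v N) z / poly (lin_prod u N) z =
    1 - (\<Sum>k<N. of_real (u k) * z / (1 - of_real (u k) * z))"
proof -
  have "lin_prod v N = pderiv (pCons 0 (lin_prod u N :: 'a poly))"
    by (rule poly_eqI) (simp add: coeff_pderiv coeff_lin_prod_of_real[where 'a = 'a] coeff
        del: of_nat_Suc)
  then have "poly (lin_prod v N) z = poly (lin_prod u N) z + z * poly (pderiv (lin_prod u N)) z"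
    by (simp add: pderiv_pCons)
  also have "\<dots> = poly (lin_prod u N) z * (1 - (\<Sum>k<N. of_real (u k) * z / (1 - of_real (u k) * z)))"
    by (subst poly_pderiv_lin_prod) (use nz in \<open>simp_all add: algebra_simps sum_distrib_left sum_negf\<close>)
  finally show ?thesis
    using nz by (simp add: poly_lin_prod)
qed

text \<open>Termwise Re (w / (1 - w)) \<le> |w| / (1 - |w|) for w = u k z, with equality at the real
  point |z|.\<close>

lemma Re_lin_prod_ratio_ge:
  fixes z :: complex
  assumes coeff: "\<And>n. coeff (lin_prod v N) n = real (Suc n) * coeff (lin_prod u N) n"
    and u: "\<And>k. k < N \<Longrightarrow> 0 \<le> u k \<and> u k * cmod z < 1"
  shows "poly (lin_prod v N) (cmod z) / poly (lin_prod u N) (cmod z)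
    \<le> Re (poly (lin_prod v N) z / poly (lin_prod u N) z)"
proof -
  have norm: "cmod (complex_of_real (u k) * z) = u k * cmod z" if "k < N" for k
    using u[OF that] by (simp add: norm_mult)
  have le: "1 - u k * cmod z \<le> cmod (1 - complex_of_real (u k) * z)" if "k < N" for k
    using norm_triangle_ineq2[of 1 "complex_of_real (u k) * z"] norm[OF that] by simp
  have nz: "1 - complex_of_real (u k) * z \<noteq> 0" if "k < N" for k
    using le[OF that] u[OF that] by auto
  have nzr: "1 - of_real (u k) * cmod z \<noteq> 0" if "k < N" for k
    using u[OF that] by simp
  have "Re (complex_of_real (u k) * z / (1 - complex_of_real (u k) * z)) \<le> u k * cmod z / (1 - u k * cmod z)"
    if "k < N" for k
  proof -
    have "Re (complex_of_real (u k) * z / (1 - complex_of_real (u k) * z))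
        \<le> cmod (complex_of_real (u k) * z / (1 - complex_of_real (u k) * z))"
      by (rule complex_Re_le_cmod)
    also have "\<dots> = u k * cmod z / cmod (1 - complex_of_real (u k) * z)"
      by (simp only: norm_divide norm[OF that])
    also have "\<dots> \<le> u k * cmod z / (1 - u k * cmod z)"
      using le[OF that] u[OF that] by (intro divide_left_mono mult_pos_pos mult_nonneg_nonneg) auto
    finally show ?thesis .
  qed
  then have "(\<Sum>k<N. Re (complex_of_real (u k) * z / (1 - complex_of_real (u k) * z)))
      \<le> (\<Sum>k<N. u k * cmod z / (1 - u k * cmod z))"
    by (intro sum_mono) simp
  moreover have "poly (lin_prod v N) z / poly (lin_prod u N) z =
      1 - (\<Sum>k<N. complex_of_real (u k) * z / (1 - complex_of_real (u k) * z))"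
    by (rule poly_lin_prod_ratio[OF coeff]) (fact nz)
  moreover have "poly (lin_prod v N) (cmod z) / poly (lin_prod u N) (cmod z) =
      1 - (\<Sum>k<N. of_real (u k) * cmod z / (1 - of_real (u k) * cmod z))"
    by (rule poly_lin_prod_ratio[OF coeff]) (fact nzr)
  ultimately show ?thesis by simp
qed

text \<open>The right side is a sum of nonnegative terms \<open>w k ^ j * (w 0 - w k)\<close>.
  Keeping one of them gives the margin that makes the Euler-Rayleigh upper bounds strict in the
  limit.\<close>

lemma power_sum_gap:
  fixes w :: "nat \<Rightarrow> real"
  assumes "\<And>k. k < N \<Longrightarrow> 0 \<le> w k \<and> w k \<le> w 0" "m < N"
  shows "w m ^ j * (w 0 - w m) \<le> w 0 * (\<Sum>k<N. w k ^ j) - (\<Sum>k<N. w k ^ Suc j)"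
proof -
  have "w 0 * (\<Sum>k<N. w k ^ j) - (\<Sum>k<N. w k ^ Suc j) = (\<Sum>k<N. w k ^ j * (w 0 - w k))"
    by (simp add: sum_distrib_left sum_subtractf[symmetric] algebra_simps)
  moreover have "w m ^ j * (w 0 - w m) \<le> (\<Sum>k<N. w k ^ j * (w 0 - w k))"
    by (rule member_le_sum) (use assms in auto)
  ultimately show ?thesis by simp
qed

text \<open>All strict inequalities come from margins that are uniform along the approximating polynomials:
  their reciprocal zeros satisfy \<open>V N k \<ge> q ^ Suc k\<close> and \<open>V N (Suc k) \<le> q ^ k * V N 0\<close>.\<close>
lemma hx_smallest_zero:
  assumes q: "0 < q" "q < 1" and a: "0 < a" "a < 1"
  defines "e n \<equiv> real (Suc n) * hx_weight q a n"
  obtains \<gamma> where "0 < \<gamma>" "hx_series q a 1 \<gamma> = 0" "0 < e 1 ^ 3 - 3 * e 1 * e 2 + 3 * e 3"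
    "\<And>r. 0 \<le> r \<Longrightarrow> r < \<gamma> \<Longrightarrow> 0 < hx_series q a 1 r"
    "\<And>z::complex. cmod z < \<gamma> \<Longrightarrow> 0 < Re (hx_series q a 1 z / hx_series q a 0 z)"
    "1 < e 1 * \<gamma>" "1 < (e 1 ^ 2 - 2 * e 2) * \<gamma> ^ 2"
    "(e 1 ^ 2 - 2 * e 2) * \<gamma> < e 1"
    "(e 1 ^ 3 - 3 * e 1 * e 2 + 3 * e 3) * \<gamma> < e 1 ^ 2 - 2 * e 2"
proof -
  have "\<exists>u v. (\<forall>n. coeff (lin_prod u N) n = (-1) ^ n * hx_weight q a n * hx_damping q a N n)
    \<and> (\<forall>n. coeff (lin_prod v N) n = real (Suc n) * ((-1) ^ n * hx_weight q a n) * hx_damping q a N n)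
    \<and> (\<forall>k<N. q ^ Suc k \<le> u k \<and> u k \<le> v k)
    \<and> (\<forall>k. Suc k < N \<longrightarrow> u (Suc k) \<le> q * u k \<and> v (Suc k) \<le> u k)" for N
    using hx_approximants[OF q a, of N] by metis
  then obtain U V where UV:
    "\<And>N n. coeff (lin_prod (U N) N) n = (-1) ^ n * hx_weight q a n * hx_damping q a N n"
    "\<And>N n. coeff (lin_prod (V N) N) n = real (Suc n) * ((-1) ^ n * hx_weight q a n) * hx_damping q a N n"
    "\<And>N k. k < N \<Longrightarrow> q ^ Suc k \<le> U N k" "\<And>N k. k < N \<Longrightarrow> U N k \<le> V N k"
    "\<And>N k. Suc k < N \<Longrightarrow> U N (Suc k) \<le> q * U N k" "\<And>N k. Suc k < N \<Longrightarrow> V N (Suc k) \<le> U N k"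
    by metis
  have Upos: "0 < U N k" if "k < N" for N k
    using UV(3)[OF that] q by (meson less_le_trans zero_less_power)
  have Vpos: "0 < V N k" if "k < N" for N k
    using UV(4)[OF that] Upos[OF that] by simp
  have Upow: "U N k \<le> q ^ k * U N 0" if "k < N" for N k
    using that
  proof (induction k)
    case (Suc k)
    then have "q * U N k \<le> q * (q ^ k * U N 0)" using q by (intro mult_left_mono) auto
    then show ?case using UV(5)[of k N] Suc.prems by (simp add: mult.assoc)
  qed simp
  have UU: "U N k \<le> U N 0" if "k < N" for N k
  proof -
    have "q ^ k * U N 0 \<le> 1 * U N 0"
      using q Upos[of 0 N] that by (intro mult_right_mono) (auto simp: power_le_one)
    then show ?thesis using Upow[OF that] by simp
  qed
  have UV0: "U N 0 \<le> V N 0" if "0 < N" for N using UV(4)[OF that] .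
  have VV: "V N k \<le> V N 0" if "k < N" for N k
  proof (cases k)
    case (Suc m)
    then show ?thesis using UV(6)[of m N] UU[of m N] UV0[of N] that by fastforce
  qed simp
  \<comment> \<open>\<open>K\<close> does not depend on N, so one fixed index has a reciprocal zero
    at most half the largest in every approximant.\<close>
  obtain K where K: "q ^ K < 1 / 2" using real_arch_pow_inv[of "1/2" q] q by auto
  have Vhalf: "V N (Suc K) \<le> V N 0 / 2" if "Suc K < N" for N
  proof -
    have "V N (Suc K) \<le> q ^ K * U N 0" using UV(6)[OF that] Upow[of K N] that by simp
    also have "\<dots> \<le> 1 / 2 * U N 0" using K Upos[of 0 N] that by (intro mult_right_mono) auto
    finally show ?thesis using UV0[of N] that by simp
  qed
  have epos: "0 < e n" for n using hx_weight_pos[OF q a(2)] by (simp add: e_def)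
  have coeffV: "coeff (lin_prod (V N) N) n = (-1) ^ n * e n * hx_damping q a N n" for N n
    by (simp add: UV(2) e_def del: of_nat_Suc)
  have S1le: "(\<Sum>k<N. V N k) \<le> e 1" for N
    using epos[of 1] hx_damping_bounds[OF q a, of N 1]
    by (simp add: newton_1 coeffV mult_left_le)
  have V0le: "V N 0 \<le> e 1" if "0 < N" for N
  proof -
    have "V N 0 \<le> (\<Sum>k<N. V N k)"
      by (rule member_le_sum) (use that Vpos in \<open>auto simp: less_imp_le\<close>)
    then show ?thesis using S1le[of N] by linarith
  qed
  \<comment> \<open>The largest reciprocal zeros; the shift puts the indices 0, 1 and
    \<open>Suc K\<close> below the number of factors.\<close>
  define X where "X i = V (i + (K + 2)) 0" for i
  have X: "q \<le> X i" "X i \<le> e 1" for i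
    using UV(3)[of 0 "i + (K + 2)"] UV(4)[of 0 "i + (K + 2)"] V0le[of "i + (K + 2)"]
    by (auto simp: X_def)
  have "bounded (range X)"
  proof (rule boundedI)
    show "norm x \<le> e 1" if "x \<in> range X" for x
      using that X q by (smt (verit) image_iff real_norm_def)
  qed
  \<comment> \<open>Bolzano-Weierstrass along a subsequence; 1 / v will be \<gamma>.\<close>
  then obtain v s where s: "strict_mono (s :: nat \<Rightarrow> nat)" and v: "(X \<circ> s) \<longlonglongrightarrow> v"
    using bounded_imp_convergent_subsequence by blast
  define N where "N i = s i + (K + 2)" for i
  have Nlim: "filterlim N at_top sequentially"
    unfolding N_def using filterlim_subseq[OF s]
    by (rule filterlim_at_top_mono) auto
  have NK: "Suc K < N i" "0 < N i" "Suc 0 < N i" for i by (auto simp: N_def)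
  have V0: "(\<lambda>i. V (N i) 0) \<longlonglongrightarrow> v" using v by (simp add: X_def N_def o_def)
  have vq: "q \<le> v" by (rule LIMSEQ_le_const[OF v]) (use X in auto)
  then have vpos: "0 < v" using q by simp
  have coefflim: "(\<lambda>i. coeff (lin_prod (V (N i)) (N i)) n) \<longlonglongrightarrow> (-1) ^ n * e n" for n
    using tendsto_mult[OF tendsto_const filterlim_compose[OF hx_damping_tendsto[OF q] Nlim], of "(-1) ^ n * e n" a n]
    by (simp add: coeffV)
  have S1: "(\<lambda>i. \<Sum>k<N i. V (N i) k) \<longlonglongrightarrow> e 1"
    unfolding newton_1 using tendsto_minus[OF coefflim[of 1]] by simp
  have S2: "(\<lambda>i. \<Sum>k<N i. V (N i) k ^ 2) \<longlonglongrightarrow> e 1 ^ 2 - 2 * e 2"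
  proof -
    have "(\<lambda>i. \<Sum>k<N i. V (N i) k ^ 2) \<longlonglongrightarrow> ((-1) ^ 1 * e 1) ^ 2 - 2 * ((-1) ^ 2 * e 2)"
      unfolding newton_2 by (intro tendsto_intros coefflim)
    then show ?thesis by simp
  qed
  have S3: "(\<lambda>i. \<Sum>k<N i. V (N i) k ^ 3) \<longlonglongrightarrow> e 1 ^ 3 - 3 * e 1 * e 2 + 3 * e 3"
  proof -
    have "(\<lambda>i. \<Sum>k<N i. V (N i) k ^ 3) \<longlonglongrightarrow>
        3 * ((-1) ^ 1 * e 1) * ((-1) ^ 2 * e 2) - ((-1) ^ 1 * e 1) ^ 3 - 3 * ((-1) ^ 3 * e 3)"
      unfolding newton_3 by (intro tendsto_intros coefflim)
    then show ?thesis by simp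
  qed
  \<comment> \<open>The second reciprocal zero is at least q^2 and adds a margin to the bound of a
    power sum by its largest term.\<close>
  have two: "V (N i) 0 ^ j + (q ^ 2) ^ j \<le> (\<Sum>k<N i. V (N i) k ^ j)" for i j
  proof -
    have "q ^ 2 \<le> V (N i) 1"
      using UV(3)[of 1 "N i"] UV(4)[of 1 "N i"] NK[of i] by (simp add: power2_eq_square)
    then have "V (N i) 0 ^ j + (q ^ 2) ^ j \<le> (\<Sum>k\<in>{0, 1}. V (N i) k ^ j)"
      using q by (simp add: power_mono)
    also have "\<dots> \<le> (\<Sum>k<N i. V (N i) k ^ j)"
      by (rule sum_mono2) (use NK[of i] Vpos in \<open>auto simp: less_imp_le\<close>)
    finally show ?thesis .
  qed
  \<comment> \<open>At index \<open>Suc K\<close> the distance to the largest reciprocal zero is at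
    least q / 2.\<close>
  have gap: "(q ^ Suc (Suc K)) ^ j * (q / 2) \<le>
      V (N i) 0 * (\<Sum>k<N i. V (N i) k ^ j) - (\<Sum>k<N i. V (N i) k ^ Suc j)" for i j
  proof -
    have "q ^ Suc (Suc K) \<le> V (N i) (Suc K)"
      using UV(3)[of "Suc K" "N i"] UV(4)[of "Suc K" "N i"] NK[of i] by simp
    moreover have "q \<le> V (N i) 0"
      using UV(3)[of 0 "N i"] UV(4)[of 0 "N i"] NK[of i] by simp
    ultimately have "(q ^ Suc (Suc K)) ^ j * (q / 2) \<le> V (N i) (Suc K) ^ j * (V (N i) 0 - V (N i) (Suc K))"
      using q Vhalf[OF NK(1)[of i]] Vpos[OF NK(1)[of i]] by (intro mult_mono power_mono) auto
    also have "\<dots> \<le> V (N i) 0 * (\<Sum>k<N i. V (N i) k ^ j) - (\<Sum>k<N i. V (N i) k ^ Suc j)"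
      by (rule power_sum_gap) (use NK[of i] VV Vpos in \<open>auto simp: less_imp_le\<close>)
    finally show ?thesis .
  qed
  \<comment> \<open>The margins are independent of i, so strictness survives the limits;
    \<open>b5\<close> gives positivity of the third power sum.\<close>
  have b1: "v + q ^ 2 \<le> e 1"
    by (rule LIMSEQ_le[OF tendsto_add[OF V0 tendsto_const] S1]) (use two[of _ 1] in auto)
  have b2: "v ^ 2 + (q ^ 2) ^ 2 \<le> e 1 ^ 2 - 2 * e 2"
    by (rule LIMSEQ_le[OF tendsto_add[OF tendsto_power[OF V0] tendsto_const] S2]) (use two[of _ 2] in auto)
  have b5: "v ^ 3 + (q ^ 2) ^ 3 \<le> e 1 ^ 3 - 3 * e 1 * e 2 + 3 * e 3"
    by (rule LIMSEQ_le[OF tendsto_add[OF tendsto_power[OF V0] tendsto_const] S3]) (use two[of _ 3] in auto)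
  have b3: "(q ^ Suc (Suc K)) ^ 1 * (q / 2) \<le> v * e 1 - (e 1 ^ 2 - 2 * e 2)"
    by (rule LIMSEQ_le_const[OF tendsto_diff[OF tendsto_mult[OF V0 S1] S2]])
       (use gap[of 1] in \<open>auto simp: numeral_2_eq_2\<close>)
  have b4: "(q ^ Suc (Suc K)) ^ 2 * (q / 2) \<le> v * (e 1 ^ 2 - 2 * e 2) - (e 1 ^ 3 - 3 * e 1 * e 2 + 3 * e 3)"
    by (rule LIMSEQ_le_const[OF tendsto_diff[OF tendsto_mult[OF V0 S2] S3]])
       (use gap[of 2] in \<open>auto simp: numeral_2_eq_2 numeral_3_eq_3\<close>)
  have Hlim: "(\<lambda>i. poly (lin_prod (V (N i)) (N i)) (Z i)) \<longlonglongrightarrow> hx_series q a 1 z"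
    if "Z \<longlonglongrightarrow> z" for Z and z :: "'b::{real_normed_field,banach}"
    by (rule hx_series_approx[OF q a Nlim that]) (simp add: UV(2))
  have Plim: "(\<lambda>i. poly (lin_prod (U (N i)) (N i)) (Z i)) \<longlonglongrightarrow> hx_series q a 0 z"
    if "Z \<longlonglongrightarrow> z" for Z and z :: "'b::{real_normed_field,banach}"
    by (rule hx_series_approx[OF q a Nlim that]) (simp add: UV(1))
  \<comment> \<open>The polynomials are evaluated at their own smallest zeros, which converge to 1 /
    v.\<close>
  have zero: "hx_series q a 1 (1 / v) = 0"
  proof -
    have "(\<lambda>i. poly (lin_prod (V (N i)) (N i)) (1 / V (N i) 0)) \<longlonglongrightarrow> hx_series q a 1 (1 / v)"
      by (rule Hlim) (use vpos in \<open>auto intro!: tendsto_intros V0\<close>)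
    moreover have "poly (lin_prod (V (N i)) (N i)) (1 / V (N i) 0) = 0" for i
      unfolding poly_lin_prod using NK[of i] Vpos[OF NK(2)[of i]] by (intro prod_zero bexI[of _ 0]) auto
    ultimately show ?thesis by (simp add: LIMSEQ_const_iff)
  qed
  have ev: "eventually (\<lambda>i. V (N i) 0 * r < t) sequentially" if "v * r < t" for r t
    using tendsto_mult[OF V0 tendsto_const, of r] that by (rule order_tendstoD)
  have Hpos: "0 < hx_series q a 1 r" if r: "0 \<le> r" "r < 1 / v" for r :: real
  proof -
    \<comment> \<open>The midpoint of v r and 1. Eventually all \<open>V (N i) k * r\<close> are at
      most \<open>t\<close>, and their sum is at most \<open>e 1 * r\<close>, so the products stay
      above a fixed positive number.\<close>
    define t where "t = (1 + v * r) / 2"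
    have vr: "0 \<le> v * r" "v * r < 1" using r vpos by (auto simp: field_simps)
    then have t: "0 < t" "t < 1" "v * r < t" by (auto simp: t_def mult.commute)
    have "eventually (\<lambda>i. (1 - t) powr (e 1 * r / t) \<le> poly (lin_prod (V (N i)) (N i)) r) sequentially"
      using ev[OF t(3)]
    proof eventually_elim
      case (elim i)
      have "0 \<le> V (N i) k * r \<and> V (N i) k * r \<le> t" if "k < N i" for k
        using Vpos[OF that] mult_right_mono[OF VV[OF that] r(1)] r elim by auto
      then have "(1 - t) powr ((\<Sum>k<N i. V (N i) k * r) / t) \<le> poly (lin_prod (V (N i)) (N i)) r"
        unfolding poly_lin_prod of_real_eq_id id_apply by (rule prod_one_minus_ge_powr[OF t(1,2)])
      moreover have "(\<Sum>k<N i. V (N i) k * r) / t \<le> e 1 * r / t"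
        using S1le[of "N i"] r t by (simp add: sum_distrib_right[symmetric] divide_right_mono mult_right_mono)
      then have "(1 - t) powr (e 1 * r / t) \<le> (1 - t) powr ((\<Sum>k<N i. V (N i) k * r) / t)"
        using t by (intro powr_mono') auto
      ultimately show ?case by linarith
    qed
    then have "(1 - t) powr (e 1 * r / t) \<le> hx_series q a 1 r"
      by (intro tendsto_lowerbound[OF Hlim[OF tendsto_const]]) auto
    moreover have "0 < (1 - t) powr (e 1 * r / t)" using t by simp
    ultimately show ?thesis by linarith
  qed
  \<comment> \<open>On this disc |\<phi>(z)| \<ge> \<phi>(|z|) \<ge> h'(|z|) > 0, so
    \<open>Re_lin_prod_ratio_ge\<close> passes to the limit as a quotient.\<close>
  have star: "0 < Re (hx_series q a 1 z / hx_series q a 0 z)" if z: "cmod z < 1 / v" for z :: complex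
  proof -
    have H: "0 < hx_series q a 1 (cmod z)" using Hpos z by simp
    have "v * cmod z < 1" using z vpos by (simp add: field_simps)
    from ev[OF this] have evU: "eventually (\<lambda>i. \<forall>k<N i. U (N i) k * cmod z < 1 \<and> V (N i) k * cmod z < 1) sequentially"
    proof eventually_elim
      case (elim i)
      have "V (N i) k * cmod z < 1" if "k < N i" for k
        using mult_right_mono[OF VV[OF that], of "cmod z"] elim by simp
      moreover have "U (N i) k * cmod z \<le> V (N i) k * cmod z" if "k < N i" for k
        using UV(4)[OF that] by (simp add: mult_right_mono)
      ultimately show ?case by (meson le_less_trans)
    qed
    have "eventually (\<lambda>i. poly (lin_prod (V (N i)) (N i)) (cmod z) \<le> poly (lin_prod (U (N i)) (N i)) (cmod z)) sequentially"
      using evU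
    proof eventually_elim
      case (elim i)
      then show ?case unfolding poly_lin_prod
        using UV(4) by (intro prod_mono) (auto simp: mult_right_mono less_imp_le)
    qed
    then have "hx_series q a 1 (cmod z) \<le> hx_series q a 0 (cmod z)"
      by (rule tendsto_le[OF sequentially_bot Plim[OF tendsto_const] Hlim[OF tendsto_const]])
    with H have P: "0 < hx_series q a 0 (cmod z)" by linarith
    have "eventually (\<lambda>i. poly (lin_prod (U (N i)) (N i)) (cmod z) \<le> cmod (poly (lin_prod (U (N i)) (N i)) z)) sequentially"
      using evU
    proof eventually_elim
      case (elim i)
      have "1 - U (N i) k * cmod z \<le> cmod (1 - complex_of_real (U (N i) k) * z)" if "k < N i" for k
        using norm_triangle_ineq2[of 1 "complex_of_real (U (N i) k) * z"] Upos[OF that] by (simp add: norm_mult)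
      then show ?case unfolding poly_lin_prod prod_norm[symmetric]
        using elim by (intro prod_mono) (auto simp: less_imp_le)
    qed
    then have "hx_series q a 0 (cmod z) \<le> cmod (hx_series q a 0 z)"
      by (rule tendsto_le[OF sequentially_bot tendsto_norm[OF Plim[OF tendsto_const]] Plim[OF tendsto_const]])
    with P have nz: "hx_series q a 0 z \<noteq> 0" by auto
    have "eventually (\<lambda>i. poly (lin_prod (V (N i)) (N i)) (cmod z) / poly (lin_prod (U (N i)) (N i)) (cmod z)
        \<le> Re (poly (lin_prod (V (N i)) (N i)) z / poly (lin_prod (U (N i)) (N i)) z)) sequentially"
      using evU
    proof eventually_elim
      case (elim i)
      then show ?case
        using Upos by (intro Re_lin_prod_ratio_ge) (auto simp: UV(1,2) less_imp_le)
    qed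
    then have "hx_series q a 1 (cmod z) / hx_series q a 0 (cmod z) \<le> Re (hx_series q a 1 z / hx_series q a 0 z)"
      using P nz
      by (intro tendsto_le[OF sequentially_bot
            tendsto_Re[OF tendsto_divide[OF Hlim[OF tendsto_const] Plim[OF tendsto_const]]]
            tendsto_divide[OF Hlim[OF tendsto_const] Plim[OF tendsto_const]]]) auto
    with H P show ?thesis by (meson divide_pos_pos less_le_trans)
  qed
  show thesis
  proof (rule that[of "1 / v"])
    have "0 < q ^ Suc (Suc K)" "0 < q ^ 2" using q by simp_all
    then have c: "v < e 1" "v ^ 2 < e 1 ^ 2 - 2 * e 2" "e 1 ^ 2 - 2 * e 2 < v * e 1"
      "e 1 ^ 3 - 3 * e 1 * e 2 + 3 * e 3 < v * (e 1 ^ 2 - 2 * e 2)"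
      using b1 b2 b3 b4 q
      by (smt (verit) zero_less_power mult_pos_pos half_gt_zero)+
    have "0 < v ^ 3" "0 < (q ^ 2) ^ 3" using vpos q by simp_all
    then show "0 < e 1 ^ 3 - 3 * e 1 * e 2 + 3 * e 3" using b5 by linarith
    show "1 < e 1 * (1 / v)" using c(1) vpos by (simp add: field_simps)
    show "1 < (e 1 ^ 2 - 2 * e 2) * (1 / v) ^ 2"
      using c(2) vpos by (simp add: power_divide less_divide_eq)
    show "(e 1 ^ 2 - 2 * e 2) * (1 / v) < e 1"
      using c(3) vpos by (simp add: divide_less_eq mult.commute)
    show "(e 1 ^ 3 - 3 * e 1 * e 2 + 3 * e 3) * (1 / v) < e 1 ^ 2 - 2 * e 2"
      using c(4) vpos by (simp add: divide_less_eq mult.commute)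
  qed (use vpos zero Hpos star in auto)
qed

section \<open>Identification with the Hahn-Exton functions\<close>

text \<open>Lets the prefactor of J be cancelled. The factors are positive and their deviations from
  1 summable.\<close>

lemma qpoch_inf_nonzero:
  assumes "0 < q" "q < 1" "0 < a" "a < 1"
  shows "qpoch_inf a q \<noteq> 0"
proof -
  have "summable (\<lambda>k. a * q ^ k)" using assms by (intro summable_mult summable_geometric) auto
  then have "convergent_prod (\<lambda>k. 1 + - (a * q ^ k))"
    using mult_power_less_1[of q a] assms
    by (intro summable_imp_convergent_prod_real) (auto simp: less_imp_neq)
  then have "convergent_prod (\<lambda>k. 1 - a * q ^ k)" by simp
  then show ?thesis
    unfolding qpoch_inf_def using mult_power_less_1[of q a] assms
    by (intro prodinf_nonzero) (auto simp: less_imp_neq)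
qed

lemma hx_series_sums:
  fixes z :: "'a::{real_normed_field,banach}"
  assumes "0 < q" "q < 1" "0 < a" "a < 1"
  shows "(\<lambda>n. of_real (real (Suc n) ^ j * ((-1) ^ n * hx_weight q a n)) * z ^ n) sums hx_series q a j z"
  \<comment> \<open>The alternating sign is absorbed into the argument.\<close>
  using hx_weight_summable[OF assms, of j "- z"]
  unfolding hx_series_def
  by (intro summable_sums) (simp add: power_minus[of z] mult_ac)

text \<open>Termwise differentiation, with (n + 1) c n split as c n + n c n.\<close>

lemma hx_series_has_field_derivative:
  fixes z :: "'a::{real_normed_field,banach}"
  assumes "0 < q" "q < 1" "0 < a" "a < 1"
  obtains D where "(hx_series q a 0 has_field_derivative D) (at z)"
    "hx_series q a 1 z = hx_series q a 0 z + z * D"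
proof -
  define c :: "nat \<Rightarrow> 'a" where "c n = of_real ((-1) ^ n * hx_weight q a n)" for n
  have c: "(\<lambda>n. c n * y ^ n) sums hx_series q a 0 y" for y
    using hx_series_sums[OF assms, of 0 y] by (simp add: c_def)
  have sm: "summable (\<lambda>n. c n * y ^ n)" for y using c sums_summable by blast
  define D where "D = (\<Sum>n. diffs c n * z ^ n)"
  have "((\<lambda>x. \<Sum>n. c n * x ^ n) has_field_derivative D) (at z)"
    unfolding D_def by (rule termdiffs_strong_converges_everywhere[OF sm])
  moreover have "(\<lambda>x. \<Sum>n. c n * x ^ n) = hx_series q a 0"
    using c by (auto simp: sums_iff)
  moreover have "(\<lambda>n. of_nat n * c n * z ^ (n - Suc 0)) sums D"
    unfolding D_def by (rule diffs_equiv[OF termdiff_converges_all[OF sm]])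
  from sums_add[OF c sums_mult[OF this, of z]]
  have "(\<lambda>n. c n * z ^ n + z * (of_nat n * c n * z ^ (n - Suc 0))) sums (hx_series q a 0 z + z * D)" .
  moreover have "c n * z ^ n + z * (of_nat n * c n * z ^ (n - Suc 0)) =
      of_real (real (Suc n) ^ 1 * ((-1) ^ n * hx_weight q a n)) * z ^ n" for n
    by (cases n) (simp_all add: c_def algebra_simps)
  ultimately show thesis
    using that[of D] hx_series_sums[OF assms, of 1 z] by (simp add: sums_unique2 del: One_nat_def)
qed

section \<open>The functions h and J in terms of \<open>hx_series\<close>\<close>

lemma q_powr_triangular:
  assumes "0 < q"
  shows "q powr (real n * (real n + 1) / 2) = q ^ (n * (n + 1) div 2)"
proof -
  have "real (n * (n + 1) div 2) = real n * (real n + 1) / 2"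
    by (subst real_of_nat_div) (auto simp: algebra_simps)
  then show ?thesis using powr_realpow[OF assms, of "n * (n + 1) div 2"] by (simp only:)
qed

lemma q_powr_less_1:
  fixes q \<nu> :: real
  assumes "0 < q" "q < 1" "\<nu> > -1"
  shows "0 < q powr (\<nu> + 1)" "q powr (\<nu> + 1) < 1"
  using assms powr_less_mono'[of q 0 "\<nu> + 1"] by auto

lemma h3_eq_hx_series:
  assumes "0 < q" "q < 1" "\<nu> > -1"
  shows "h3 q \<nu> z = z * hx_series q (q powr (\<nu> + 1)) 0 z"
proof -
  have "(\<lambda>n. z * (of_real (real (Suc n) ^ 0 * ((-1) ^ n * hx_weight q (q powr (\<nu> + 1)) n)) * z ^ n))
      sums (z * hx_series q (q powr (\<nu> + 1)) 0 z)"
    using q_powr_less_1[OF assms] assms by (intro sums_mult hx_series_sums) auto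
  then show ?thesis
    unfolding h3_def q_powr_triangular[OF assms(1)]
    by (simp add: sums_iff hx_weight_def mult_ac)
qed

lemma deriv_h3:
  assumes "0 < q" "q < 1" "\<nu> > -1"
  shows "deriv (h3 q \<nu>) z = hx_series q (q powr (\<nu> + 1)) 1 z"
proof -
  obtain D where D: "(hx_series q (q powr (\<nu> + 1)) 0 has_field_derivative D) (at z)"
    "hx_series q (q powr (\<nu> + 1)) 1 z = hx_series q (q powr (\<nu> + 1)) 0 z + z * D"
    using hx_series_has_field_derivative q_powr_less_1[OF assms] assms by metis
  have "h3 q \<nu> = (\<lambda>z. z * hx_series q (q powr (\<nu> + 1)) 0 z)"
    using h3_eq_hx_series[OF assms] by auto
  moreover have "((\<lambda>z. z * hx_series q (q powr (\<nu> + 1)) 0 z) has_field_derivative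
      hx_series q (q powr (\<nu> + 1)) 1 z) (at z)"
    by (rule derivative_eq_intros D(1) refl)+ (simp add: D(2) mult.commute del: One_nat_def)
  ultimately show ?thesis by (simp add: DERIV_imp_deriv)
qed

lemma hahn_exton_J_eq_hx_series:
  assumes "0 < q" "q < 1" "\<nu> > -1" "0 < r"
  shows "hahn_exton_J q \<nu> r =
    qpoch_inf (q powr (\<nu> + 1)) q / qpoch_inf q q * (r powr \<nu> * hx_series q (q powr (\<nu> + 1)) 0 (r ^ 2))"
proof -
  have "(\<lambda>n. r powr \<nu> * (of_real (real (Suc n) ^ 0 * ((-1) ^ n * hx_weight q (q powr (\<nu> + 1)) n)) * (r ^ 2) ^ n))
      sums (r powr \<nu> * hx_series q (q powr (\<nu> + 1)) 0 (r ^ 2))"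
    using q_powr_less_1[OF assms(1-3)] assms by (intro sums_mult hx_series_sums) auto
  moreover have "r powr (2 * real n + \<nu>) = r powr \<nu> * (r ^ 2) ^ n" for n
    using powr_realpow[OF assms(4), of "2 * n"] by (simp add: powr_add power_mult)
  ultimately show ?thesis
    unfolding hahn_exton_J_def q_powr_triangular[OF assms(1)]
    by (simp add: sums_iff hx_weight_def mult_ac)
qed

text \<open>J(r) is a constant times r^\<nu> \<phi>(r^2); the terms with factor \<nu> cancel and 2
  \<phi>(r^2) + 2 r^2 \<phi>'(r^2) = 2 h'(r^2) remains. So a zero \<gamma> of h' matches the root
  sqrt \<gamma>.\<close>

lemma hahn_exton_J_deriv_eq:
  assumes "0 < q" "q < 1" "\<nu> > -1" "0 < r"
  shows "r * deriv (hahn_exton_J q \<nu>) r - (\<nu> - 2) * hahn_exton_J q \<nu> r =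
    2 * (qpoch_inf (q powr (\<nu> + 1)) q / qpoch_inf q q) * r powr \<nu> * hx_series q (q powr (\<nu> + 1)) 1 (r ^ 2)"
proof -
  let ?F = "hx_series q (q powr (\<nu> + 1)) 0 :: real \<Rightarrow> real"
  define C where "C = qpoch_inf (q powr (\<nu> + 1)) q / qpoch_inf q q"
  obtain D where D: "(?F has_field_derivative D) (at (r ^ 2))"
    "hx_series q (q powr (\<nu> + 1)) 1 (r ^ 2) = ?F (r ^ 2) + r ^ 2 * D"
    using hx_series_has_field_derivative q_powr_less_1[OF assms(1-3)] assms by metis
  have "((\<lambda>r. r ^ 2) has_real_derivative 2 * r) (at r)"
    by (rule derivative_eq_intros refl)+ simp
  from DERIV_chain2[OF D(1) this]
  have "((\<lambda>r. C * (r powr \<nu> * ?F (r ^ 2))) has_real_derivative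
      C * (\<nu> * r powr (\<nu> - 1) * ?F (r ^ 2) + D * (2 * r) * r powr \<nu>)) (at r)"
    using assms(4) by (intro DERIV_cmult DERIV_mult has_real_derivative_powr)
  \<comment> \<open>The closed form of J is available for positive arguments, so the derivative is
    transferred on a neighbourhood.\<close>
  moreover have "eventually (\<lambda>r. hahn_exton_J q \<nu> r = C * (r powr \<nu> * ?F (r ^ 2))) (nhds r)"
    using eventually_nhds_in_open[of "{0<..}" r] assms
    by (auto elim!: eventually_mono simp: hahn_exton_J_eq_hx_series C_def)
  ultimately have "(hahn_exton_J q \<nu> has_real_derivative
      C * (\<nu> * r powr (\<nu> - 1) * ?F (r ^ 2) + D * (2 * r) * r powr \<nu>)) (at r)"
    by (subst DERIV_cong_ev[OF refl _ refl])
  then have deriv: "deriv (hahn_exton_J q \<nu>) r = C * (\<nu> * r powr (\<nu> - 1) * ?F (r ^ 2) + D * (2 * r) * r powr \<nu>)"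
    by (rule DERIV_imp_deriv)
  have "r * r powr (\<nu> - 1) = r powr \<nu>"
    using assms(4) by (simp add: powr_diff)
  then have "r * deriv (hahn_exton_J q \<nu>) r = C * (\<nu> * r powr \<nu> * ?F (r ^ 2) + D * (2 * r ^ 2) * r powr \<nu>)"
    unfolding deriv by (simp add: algebra_simps power2_eq_square)
  then show ?thesis
    unfolding D(2) hahn_exton_J_eq_hx_series[OF assms] C_def[symmetric] by (simp add: algebra_simps)
qed

text \<open>Every r up to and including \<gamma> is admissible, since only the open disc is tested;
  beyond that the point z = \<gamma>, where the quotient is 0, is an obstruction.\<close>

lemma radius_starlike_h3:
  assumes "0 < q" "q < 1" "\<nu> > -1" and "0 < \<gamma>"
    and zero: "hx_series q (q powr (\<nu> + 1)) 1 \<gamma> = 0"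
    and star: "\<And>z::complex. cmod z < \<gamma> \<Longrightarrow>
      0 < Re (hx_series q (q powr (\<nu> + 1)) 1 z / hx_series q (q powr (\<nu> + 1)) 0 z)"
  shows "radius_starlike (h3 q \<nu>) = \<gamma>"
proof -
  let ?a = "q powr (\<nu> + 1)"
  have eq: "z * deriv (h3 q \<nu>) z / h3 q \<nu> z = hx_series q ?a 1 z / hx_series q ?a 0 z" if "z \<noteq> 0" for z
    using that by (simp add: deriv_h3[OF assms(1-3)] h3_eq_hx_series[OF assms(1-3)])
  have "(\<lambda>n. complex_of_real (of_real (real (Suc n) ^ 1 * ((-1) ^ n * hx_weight q ?a n)) * \<gamma> ^ n))
      sums complex_of_real (hx_series q ?a 1 \<gamma>)"
    unfolding sums_of_real_iff using q_powr_less_1[OF assms(1-3)] assms by (intro hx_series_sums) auto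
  then have "hx_series q ?a 1 (complex_of_real \<gamma>) = complex_of_real (hx_series q ?a 1 \<gamma>)"
    by (simp add: sums_iff hx_series_def)
  then have zero': "hx_series q ?a 1 (complex_of_real \<gamma>) = 0" using zero by simp
  have "{r. 0 < r \<and> (\<forall>z. 0 < cmod z \<and> cmod z < r \<longrightarrow> 0 < Re (z * deriv (h3 q \<nu>) z / h3 q \<nu> z))} = {0<..\<gamma>}"
    (is "?S = _")
  proof (intro equalityI subsetI)
    fix r assume r: "r \<in> ?S"
    have "r \<le> \<gamma>"
    proof (rule ccontr)
      assume "\<not> r \<le> \<gamma>"
      then have "0 < Re (complex_of_real \<gamma> * deriv (h3 q \<nu>) \<gamma> / h3 q \<nu> \<gamma>)"
        using r \<open>0 < \<gamma>\<close> by auto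
      then show False using eq[of \<gamma>] zero' \<open>0 < \<gamma>\<close> by simp
    qed
    then show "r \<in> {0<..\<gamma>}" using r by simp
  next
    fix r assume "r \<in> {0<..\<gamma>}"
    then show "r \<in> ?S" using star eq by auto
  qed
  then show ?thesis
    unfolding radius_starlike_def using \<open>0 < \<gamma>\<close> by simp
qed

section \<open>The Euler-Rayleigh bounds\<close>

text \<open>The left sides are Newton's expressions for the power sums of the reciprocal zeros of
  h'. \<open>S\<close> and \<open>T\<close> are (1 - q^2)(1 - a q) and (1 - q^3)(1 - a q^2) divided
  by 1 - q.\<close>

lemma hx_power_sums:
  fixes q a :: real
  assumes q: "0 < q" "q < 1" and a: "0 < a" "a < 1"
  defines "e n \<equiv> real (Suc n) * hx_weight q a n"
    and "d \<equiv> (1 - q) * (1 - a)" and "S \<equiv> (1 + q) * (1 - a * q)"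
    and "T \<equiv> (1 + q + q ^ 2) * (1 - a * q ^ 2)"
  shows "e 1 = 2 * q / d"
    "e 1 ^ 2 - 2 * e 2 = 2 * q ^ 2 * (2 * S - 3 * q * (1 - a)) / (d ^ 2 * S)"
    "e 1 ^ 3 - 3 * e 1 * e 2 + 3 * e 3 =
      2 * q ^ 3 * (4 * S * T - 9 * q * (1 - a) * T + 6 * q ^ 3 * (1 - a) ^ 2) / (d ^ 3 * S * T)"
proof -
  have "0 < 1 - a * q" "0 < 1 - a * q ^ 2"
    using mult_power_less_1[OF q a(2), of 1] mult_power_less_1[OF q a(2), of 2] by simp_all
  moreover have "0 < 1 + q" "0 < 1 + q + q ^ 2" using q by (simp_all add: add_pos_pos)
  ultimately have nz: "S \<noteq> 0" "T \<noteq> 0" "d \<noteq> 0" using q a by (auto simp: S_def T_def d_def)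
  have P: "qpoch c q 1 = 1 - c" "qpoch c q 2 = (1 - c) * (1 - c * q)"
    "qpoch c q 3 = (1 - c) * (1 - c * q) * (1 - c * q ^ 2)" for c
    by (simp_all add: qpoch_def numeral_2_eq_2 numeral_3_eq_3)
  show e1: "e 1 = 2 * q / d"
    unfolding e_def hx_weight_def P d_def by simp
  \<comment> \<open>Padding with powers of 1 - a turns the denominators into products of
    \<open>d\<close>, \<open>S\<close> and \<open>T\<close>.\<close>
  have expand: "x / Q = x * (1 - a) ^ k / Y" if "Q * (1 - a) ^ k = Y" for x Q Y k
    using a by (simp add: that[symmetric])
  have "qpoch q q 2 * qpoch a q 2 * (1 - a) ^ 1 = d ^ 2 * S"
    unfolding P d_def S_def by algebra
  from expand[OF this, of "3 * q ^ 3"] have e2: "e 2 = 3 * q ^ 3 * (1 - a) / (d ^ 2 * S)"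
    unfolding e_def hx_weight_def by simp
  have "qpoch q q 3 * qpoch a q 3 * (1 - a) ^ 2 = d ^ 3 * S * T"
    unfolding P d_def S_def T_def by algebra
  from expand[OF this, of "4 * q ^ 6"] have e3: "e 3 = 4 * q ^ 6 * (1 - a) ^ 2 / (d ^ 3 * S * T)"
    unfolding e_def hx_weight_def by simp
  show "e 1 ^ 2 - 2 * e 2 = 2 * q ^ 2 * (2 * S - 3 * q * (1 - a)) / (d ^ 2 * S)"
    unfolding e1 e2 using nz by (simp add: power_divide divide_simps) algebra
  show "e 1 ^ 3 - 3 * e 1 * e 2 + 3 * e 3 =
      2 * q ^ 3 * (4 * S * T - 9 * q * (1 - a) * T + 6 * q ^ 3 * (1 - a) ^ 2) / (d ^ 3 * S * T)"
    unfolding e1 e2 e3 using nz by (simp add: power_divide divide_simps) algebra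
qed

theorem theorem6:
  fixes q \<nu> :: real
  assumes "0 < q" "q < 1" "\<nu> > -1"
  shows "(\<exists>\<rho>>0. \<rho> * deriv (hahn_exton_J q \<nu>) \<rho> - (\<nu> - 2) * hahn_exton_J q \<nu> \<rho> = 0 \<and>
            (\<forall>t. 0 < t \<and> t < \<rho> \<longrightarrow>
               t * deriv (hahn_exton_J q \<nu>) t - (\<nu> - 2) * hahn_exton_J q \<nu> t \<noteq> 0) \<and>
            radius_starlike (h3 q \<nu>) = \<rho> ^ 2)
    \<and> (1 - q) * (1 - q powr (\<nu> + 1)) / (2 * q) < radius_starlike (h3 q \<nu>)
    \<and> radius_starlike (h3 q \<nu>) <
        (q^2 - 1) * (q powr (\<nu> + 1) - 1) * (q powr (\<nu> + 2) - 1)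
        / (q * (q - q powr (\<nu> + 2) + 2 * q powr (\<nu> + 3) - 2))
    \<and> (q - 1) * (q powr (\<nu> + 1) - 1) / (2 * q) *
        sqrt (2 * (q powr (\<nu> + 2) - 1) * (q + 1) / (q - q powr (\<nu> + 2) + 2 * q powr (\<nu> + 3) - 2))
        < radius_starlike (h3 q \<nu>)
    \<and> radius_starlike (h3 q \<nu>) <
        (q powr (\<nu> + 1) - 1) * (q powr (\<nu> + 3) - 1) * (1 - q) / (q * (q + 1)) *
        ((q - q powr (\<nu> + 2) + 2 * q powr (\<nu> + 3) - 2) * (q^3 + 2 * q^2 + 2 * q + 1)
         / (q + q^2 - q^3 - 4 - 5 * q powr (\<nu> + 2) + 3 * q powr (\<nu> + 3) + 10 * q powr (\<nu> + 4)
            + 3 * q powr (\<nu> + 5) - 5 * q powr (\<nu> + 6) - q powr (2 * \<nu> + 5)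
            + q powr (2 * \<nu> + 6) + q powr (2 * \<nu> + 7) - 4 * q powr (2 * \<nu> + 8)))"
proof -
  define a where "a = q powr (\<nu> + 1)"
  have a: "0 < a" "a < 1" using q_powr_less_1[OF assms] by (simp_all add: a_def)
  have pw: "q powr (\<nu> + 2) = a * q" "q powr (\<nu> + 3) = a * q ^ 2" "q powr (\<nu> + 4) = a * q ^ 3"
    "q powr (\<nu> + 5) = a * q ^ 4" "q powr (\<nu> + 6) = a * q ^ 5" "q powr (2 * \<nu> + 5) = a ^ 2 * q ^ 3"
    "q powr (2 * \<nu> + 6) = a ^ 2 * q ^ 4" "q powr (2 * \<nu> + 7) = a ^ 2 * q ^ 5"
    "q powr (2 * \<nu> + 8) = a ^ 2 * q ^ 6"
  proof -
    have "q powr (\<nu> + 1 + real n) = a * q ^ n" for n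
      using assms(1) by (simp add: powr_add powr_realpow a_def)
    from this[of 1] this[of 2] this[of 3] this[of 4] this[of 5]
    show "q powr (\<nu> + 2) = a * q" "q powr (\<nu> + 3) = a * q ^ 2" "q powr (\<nu> + 4) = a * q ^ 3"
      "q powr (\<nu> + 5) = a * q ^ 4" "q powr (\<nu> + 6) = a * q ^ 5"
      by (simp_all add: add.assoc)
    have "q powr ((\<nu> + 1) + (\<nu> + 1) + real n) = a ^ 2 * q ^ n" for n
      unfolding powr_add[of q _ "real n"] powr_add[of q "\<nu> + 1"] using assms(1)
      by (simp add: powr_realpow a_def power2_eq_square)
    from this[of 3] this[of 4] this[of 5] this[of 6]
    show "q powr (2 * \<nu> + 5) = a ^ 2 * q ^ 3" "q powr (2 * \<nu> + 6) = a ^ 2 * q ^ 4"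
      "q powr (2 * \<nu> + 7) = a ^ 2 * q ^ 5" "q powr (2 * \<nu> + 8) = a ^ 2 * q ^ 6"
      by (simp_all add: algebra_simps)
  qed
  define e where "e n = real (Suc n) * hx_weight q a n" for n
  define d where "d = (1 - q) * (1 - a)"
  define S where "S = (1 + q) * (1 - a * q)"
  define T where "T = (1 + q + q ^ 2) * (1 - a * q ^ 2)"
  \<comment> \<open>\<open>B\<close> and \<open>E\<close> are the nontrivial numerators of the
    second and third power sums; the long polynomials of the claim are \<open>- B\<close> and
    \<open>- E\<close>.\<close>
  define B where "B = 2 * S - 3 * q * (1 - a)"
  define E where "E = 4 * S * T - 9 * q * (1 - a) * T + 6 * q ^ 3 * (1 - a) ^ 2"
  note sigma = hx_power_sums[OF assms(1,2) a, folded e_def d_def S_def T_def, folded B_def E_def]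
  obtain \<gamma> where \<gamma>: "0 < \<gamma>" "hx_series q a 1 \<gamma> = 0" "0 < e 1 ^ 3 - 3 * e 1 * e 2 + 3 * e 3"
    "\<And>r. 0 \<le> r \<Longrightarrow> r < \<gamma> \<Longrightarrow> 0 < hx_series q a 1 r"
    "\<And>z::complex. cmod z < \<gamma> \<Longrightarrow> 0 < Re (hx_series q a 1 z / hx_series q a 0 z)"
    "1 < e 1 * \<gamma>" "1 < (e 1 ^ 2 - 2 * e 2) * \<gamma> ^ 2"
    "(e 1 ^ 2 - 2 * e 2) * \<gamma> < e 1"
    "(e 1 ^ 3 - 3 * e 1 * e 2 + 3 * e 3) * \<gamma> < e 1 ^ 2 - 2 * e 2"
    using hx_smallest_zero[OF assms(1,2) a] unfolding e_def by metis
  have radius: "radius_starlike (h3 q \<nu>) = \<gamma>"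
    using radius_starlike_h3[OF assms \<gamma>(1)] \<gamma>(2,5) by (simp add: a_def)
  have J: "t * deriv (hahn_exton_J q \<nu>) t - (\<nu> - 2) * hahn_exton_J q \<nu> t = 0 \<longleftrightarrow> hx_series q a 1 (t ^ 2) = 0"
    if "0 < t" for t
    unfolding hahn_exton_J_deriv_eq[OF assms that] a_def[symmetric]
    using qpoch_inf_nonzero[OF assms(1,2) a] qpoch_inf_nonzero[OF assms(1,2) assms(1,2)] that by simp
  have root: "sqrt \<gamma> > 0 \<and> sqrt \<gamma> * deriv (hahn_exton_J q \<nu>) (sqrt \<gamma>) - (\<nu> - 2) * hahn_exton_J q \<nu> (sqrt \<gamma>) = 0 \<and>
      (\<forall>t. 0 < t \<and> t < sqrt \<gamma> \<longrightarrow> t * deriv (hahn_exton_J q \<nu>) t - (\<nu> - 2) * hahn_exton_J q \<nu> t \<noteq> 0) \<and>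
      radius_starlike (h3 q \<nu>) = sqrt \<gamma> ^ 2"
  proof (intro conjI allI impI)
    show "sqrt \<gamma> * deriv (hahn_exton_J q \<nu>) (sqrt \<gamma>) - (\<nu> - 2) * hahn_exton_J q \<nu> (sqrt \<gamma>) = 0"
      using J[of "sqrt \<gamma>"] \<gamma>(1,2) by simp
    fix t assume t: "0 < t \<and> t < sqrt \<gamma>"
    then have "t ^ 2 < sqrt \<gamma> ^ 2" by (intro power_strict_mono) auto
    then have "0 < hx_series q a 1 (t ^ 2)" using \<gamma>(1) by (intro \<gamma>(4)) auto
    then show "t * deriv (hahn_exton_J q \<nu>) t - (\<nu> - 2) * hahn_exton_J q \<nu> t \<noteq> 0"
      using J[of t] t by simp
  qed (use \<gamma>(1) radius in auto)
  have aq: "0 < 1 - a * q" "0 < 1 - a * q ^ 2"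
    using mult_power_less_1[OF assms(1,2) a(2), of 1] mult_power_less_1[OF assms(1,2) a(2), of 2] by simp_all
  have d: "0 < d" using assms a by (simp add: d_def)
  have S: "0 < S" using assms aq by (simp add: S_def)
  have T: "0 < T" using assms aq by (simp add: T_def add_pos_pos)
  \<comment> \<open>The signs of \<open>B\<close> and \<open>E\<close> are read off from the
    positivity of the power sums.\<close>
  have pos: "0 < x" if "0 < c * x / y" "0 < c" "0 < y" for c x y :: real
    using that by (auto simp: zero_less_divide_iff zero_less_mult_iff)
  have "0 < e 1 ^ 2 - 2 * e 2"
    using \<gamma>(7) by (smt (verit) mult_nonpos_nonneg zero_le_power2)
  then have B: "0 < B"
    unfolding sigma(2) by (rule pos) (use d S assms(1) in simp_all)
  have E: "0 < E"
    using \<gamma>(3) unfolding sigma(3) by (rule pos) (use d S T assms(1) in simp_all)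
  have Beq: "q - a * q + 2 * (a * q ^ 2) - 2 = - B"
    unfolding B_def S_def by algebra
  have Eeq: "q + q ^ 2 - q ^ 3 - 4 - 5 * (a * q) + 3 * (a * q ^ 2) + 10 * (a * q ^ 3)
            + 3 * (a * q ^ 4) - 5 * (a * q ^ 5) - a ^ 2 * q ^ 3
            + a ^ 2 * q ^ 4 + a ^ 2 * q ^ 5 - 4 * (a ^ 2 * q ^ 6) = - E"
    unfolding E_def S_def T_def by algebra
  have l1: "(1 - q) * (1 - a) / (2 * q) < \<gamma>"
    using \<gamma>(6) d assms(1) unfolding sigma(1) d_def[symmetric] by (simp add: field_simps)
  have u1: "\<gamma> < (q\<^sup>2 - 1) * (a - 1) * (a * q - 1) / (q * - B)"
  proof -
    have "(q\<^sup>2 - 1) * (a - 1) * (a * q - 1) = - (d * S)" unfolding d_def S_def by algebra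
    moreover have "\<gamma> < d * S / (q * B)"
      using \<gamma>(8) d S B assms(1) unfolding sigma(2) unfolding sigma(1) by (simp add: field_simps power2_eq_square)
    ultimately show ?thesis by simp
  qed
  \<comment> \<open>The square of the left side is the reciprocal of the second power sum.\<close>
  have l2: "(q - 1) * (a - 1) / (2 * q) * sqrt (2 * (a * q - 1) * (q + 1) / - B) < \<gamma>"
  proof -
    have "2 * (a * q - 1) * (q + 1) = - (2 * S)" unfolding S_def by algebra
    then have num: "2 * (a * q - 1) * (q + 1) / - B = 2 * S / B" by simp
    have num': "(q - 1) * (a - 1) = d" by (simp add: d_def algebra_simps)
    have "(d / (2 * q) * sqrt (2 * S / B)) ^ 2 = d ^ 2 * S / (2 * q ^ 2 * B)"
      using S B by (simp add: power_mult_distrib power_divide mult_ac)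
    also have "\<dots> < \<gamma> ^ 2"
      using \<gamma>(7) d S B assms(1) unfolding sigma(2) by (simp add: field_simps)
    finally show ?thesis
      unfolding num num' by (rule power_less_imp_less_base) (use \<gamma>(1) in simp)
  qed
  have u2: "\<gamma> < (a - 1) * (a * q ^ 2 - 1) * (1 - q) / (q * (q + 1)) * (- B * (q ^ 3 + 2 * q ^ 2 + 2 * q + 1) / - E)"
  proof -
    \<comment> \<open>q^3 + 2 q^2 + 2 q + 1 = (q + 1)(q^2 + q + 1): the first factor cancels, the
      second completes \<open>T\<close>.\<close>
    have "(a - 1) * (a * q ^ 2 - 1) * (1 - q) * (q ^ 3 + 2 * q ^ 2 + 2 * q + 1) = d * T * (q + 1)"
      unfolding d_def T_def by algebra
    then have "(a - 1) * (a * q ^ 2 - 1) * (1 - q) / (q * (q + 1)) * (- B * (q ^ 3 + 2 * q ^ 2 + 2 * q + 1) / - E)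
        = d * T * (q + 1) * B / (q * (q + 1) * E)"
      by (simp add: mult_ac)
    also have "\<dots> = d * T * B / (q * E)" using assms(1) by simp
    moreover have "\<gamma> < d * T * B / (q * E)"
      using \<gamma>(9) d S T B E assms(1) unfolding sigma(3) unfolding sigma(2)
      by (simp add: field_simps power2_eq_square power3_eq_cube)
    ultimately show ?thesis by simp
  qed
  show ?thesis
    unfolding radius pw a_def[symmetric] Beq Eeq
    using root l1 u1 l2 u2 unfolding radius by blast
qed

end
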